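(* Let $L \xleftarrow{i_1} I \xrightarrow{i_2} R$ be a $!$-graph equation and let $b \in {!}(I)$. Then applying any of the $!$-box operations $\mathrm{COPY}$, $\mathrm{DROP}$, $\mathrm{KILL}$ at $b$ to it, i.e. forming $\mathrm{OP}_{i_1(b)}(L) \xleftarrow{\mathrm{OP}_{i_1(b)}(i_1)} \mathrm{OP}_b(I) \xrightarrow{\mathrm{OP}_{i_2(b)}(i_2)} \mathrm{OP}_{i_2(b)}(R)$ for $\mathrm{OP} \in \{\mathrm{COPY},\mathrm{DROP},\mathrm{KILL}\}$, yields another $!$-graph equation.
   Context: Fix a compressed monoidal signature $T=(O,M,\mathrm{dom},\mathrm{cod})$, $\mathrm{dom},\mathrm{cod}: M \rightarrow (O\times\{\mathsf{v},\mathsf{f}\})^*$. The derived compressed typegraph $\mathcal{G}_T$ has vertex set $O\sqcup M$, a self-loop on each $X\in O$, an edge $\mathrm{in}^a_{f,i}$ from $X$ to $f$ for each $f\in M$ and index $i$ with $\mathrm{dom}(f)[i]=(X,a)$, and an edge $\mathrm{out}^a_{f,j}$ from $f$ to $X$ for each index $j$ with $\mathrm{cod}(f)[j]=(X,a)$. $\mathcal{G}_{T!}$ is $\mathcal{G}_T$ plus a vertex $!$, a self-loop on $!$, and an edge from $!$ to each vertex of $\mathcal{G}_T$. For a finite directed multigraph $G$ typed over $\mathcal{G}_{T!}$, vertices typed in $O$, $M$, $!$ are wire-, node-, $!$-vertices ($!(G)$ the set of $!$-vertices); fixed-arity edges are those typed by an $\mathsf{f}$-tagged edge; $U(G)$ deletes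 $!$-vertices and incident edges. A string graph is a $\mathcal{G}_T$-typed graph whose typing restricts at each node-vertex to a bijection on incident fixed-arity edges and whose wire-vertices have at most one incoming and one outgoing edge; inputs (outputs) are wire-vertices with no incoming (outgoing) edge. An open subgraph $O'$ of a string graph $K$ is a string subgraph with no vertex adjacent to a wire-vertex outside $O'$ and no incident fixed-arity edge outside $O'$. $B(b)$ is the full subgraph on successors of a $!$-vertex $b$, $\beta(G)$ the full subgraph on $!$-vertices. A $!$-graph is a $\mathcal{G}_{T!}$-typed graph with $U(G)$ a string graph, $\beta(G)$ posetal (at most one edge between two vertices, edge relation a partial order), $U(B(b))$ open in $U(G)$ for each $!$-vertex $b$, and $B(b')\subseteq B(b)$ whenever $b'\in B(b)$; $\mathbf{BGraph}_T$ is the full subcategory of $\mathbf{Graph}/\mathcal{G}_{T!}$ on $!$-graphs. $G\setminus H$ is the full subgraph on vertices not in $H$. Operations on $!$-graphs: $\mathrm{COPY}_b(G)$ is the pushout in $\mathbf{Graph}/\mathcal{G}_{T!}$ of $G \hookleftarrow G\setminus B(b) \hookrightarrow G$, with coprojections $p^G_1,p^G_2 : G \rightarrow \mathrm{COPY}_b(G)$; $\mathrm{DROP}_b(G)=G\setminus\{b\}$; $\mathrm{KILL}_b(G)=G\setminus B(b)$. $\mathrm{In}_!(G)$ (resp. $\mathrm{Out}_!(G)$) is the full subgraph on $!(G)$ and the inputs (resp. outputs) of $U(G)$; $\mathrm{Bound}_!(G)$ is the subgraph with vertices $!(G)$ and the inputs and outputs of $U(G)$, and edges those whose source is a $!$-vertex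 and target one of these vertices. A $!$-graph monomorphism $f: G\rightarrow H$ reflects $!$-box containment if every edge of $H$ from a $!$-vertex to a vertex in the image of $f$ is in the image of $f$. For such $f$ and $b \in !(G)$: $\mathrm{DROP}_{f(b)}(f) : \mathrm{DROP}_b(G)\rightarrow \mathrm{DROP}_{f(b)}(H)$ and $\mathrm{KILL}_{f(b)}(f) : \mathrm{KILL}_b(G)\rightarrow \mathrm{KILL}_{f(b)}(H)$ are the restrictions of $f$, and $\mathrm{COPY}_{f(b)}(f) : \mathrm{COPY}_b(G) \rightarrow \mathrm{COPY}_{f(b)}(H)$ is the unique morphism with $\mathrm{COPY}_{f(b)}(f)\circ p^G_k = p^H_k \circ f$ for $k=1,2$ (these are well-defined monomorphisms reflecting $!$-box containment). A $!$-graph equation is a span $L\xleftarrow{i_1} I \xrightarrow{i_2} R$ in $\mathbf{BGraph}_T$ such that: $U(L)$ and $U(R)$ have no isolated wire-vertices; there are isomorphisms $\phi_I : \mathrm{In}_!(L)\cong \mathrm{In}_!(R)$, $\phi_O : \mathrm{Out}_!(L)\cong\mathrm{Out}_!(R)$, $\phi_L:\mathrm{Bound}_!(L)\cong I$, $\phi_R:\mathrm{Bound}_!(R)\cong I$ such that, writing $j_1,j_2$ for $\phi_L$, resp. $\phi_R$, composed with the inclusions $\mathrm{In}_!(L)\hookrightarrow \mathrm{Bound}_!(L)$, resp. $\mathrm{In}_!(R)\hookrightarrow\mathrm{Bound}_!(R)$, and $k_1,k_2$ likewise for $\mathrm{Out}_!$, we have $i_1\circ j_1$ and $i_2 \circ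 j_2$ equal to the inclusions of $\mathrm{In}_!(L)$ into $L$ and of $\mathrm{In}_!(R)$ into $R$, $j_2\circ\phi_I = j_1$, and analogously $i_1\circ k_1$, $i_2\circ k_2$ are the inclusions of $\mathrm{Out}_!$ and $k_2\circ \phi_O = k_1$. *)

theory Defs
  imports "Graph_Theory.Digraph_Component" "HOL-Library.FuncSet"
begin

section \<open>Compressed monoidal signatures and their typegraphs\<close>

datatype arity = Variable | Fixed

record ('o, 'm) signature =
  objs :: "'o set"
  mors :: "'m set"
  sdom :: "'m \<Rightarrow> ('o \<times> arity) list"
  scod :: "'m \<Rightarrow> ('o \<times> arity) list"

definition compressed_monoidal_signature :: "('o, 'm) signature \<Rightarrow> bool" where
  "compressed_monoidal_signature T \<longleftrightarrow>
     (\<forall>f \<in> mors T. sdom T f \<in> lists (objs T \<times> UNIV) \<and> scod T f \<in> lists (objs T \<times> UNIV))"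

datatype ('o, 'm) tvert = Obj 'o | Mor 'm | Bang

datatype ('o, 'm) tedge =
    ObjLoop 'o
  | InEdge arity 'm nat
  | OutEdge arity 'm nat
  | BangLoop
  | BangEdge "('o, 'm) tvert"

fun tedge_tail :: "('o, 'm) signature \<Rightarrow> ('o, 'm) tedge \<Rightarrow> ('o, 'm) tvert" where
  "tedge_tail T (ObjLoop X) = Obj X"
| "tedge_tail T (InEdge a f i) = Obj (fst (sdom T f ! i))"
| "tedge_tail T (OutEdge a f j) = Mor f"
| "tedge_tail T BangLoop = Bang"
| "tedge_tail T (BangEdge x) = Bang"

fun tedge_head :: "('o, 'm) signature \<Rightarrow> ('o, 'm) tedge \<Rightarrow> ('o, 'm) tvert" where
  "tedge_head T (ObjLoop X) = Obj X"
| "tedge_head T (InEdge a f i) = Mor f"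
| "tedge_head T (OutEdge a f j) = Obj (fst (scod T f ! j))"
| "tedge_head T BangLoop = Bang"
| "tedge_head T (BangEdge x) = x"

definition typegraph :: "('o, 'm) signature \<Rightarrow> (('o, 'm) tvert, ('o, 'm) tedge) pre_digraph" where
  "typegraph T =
     \<lparr> verts = Obj ` objs T \<union> Mor ` mors T,
       arcs = ObjLoop ` objs T
         \<union> {InEdge a f i | a f i. f \<in> mors T \<and> i < length (sdom T f) \<and> snd (sdom T f ! i) = a}
         \<union> {OutEdge a f j | a f j. f \<in> mors T \<and> j < length (scod T f) \<and> snd (scod T f ! j) = a},
       tail = tedge_tail T,
       head = tedge_head T \<rparr>"

definition bang_typegraph :: "('o, 'm) signature \<Rightarrow> (('o, 'm) tvert, ('o, 'm) tedge) pre_digraph" where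
  "bang_typegraph T =
     \<lparr> verts = insert Bang (verts (typegraph T)),
       arcs = insert BangLoop (arcs (typegraph T) \<union> BangEdge ` verts (typegraph T)),
       tail = tedge_tail T,
       head = tedge_head T \<rparr>"

lemma wf_typegraph: "compressed_monoidal_signature T \<Longrightarrow> wf_digraph (typegraph T)"
  by unfold_locales
    (fastforce simp: typegraph_def compressed_monoidal_signature_def in_lists_conv_set
       dest: nth_mem)+

lemma wf_bang_typegraph:
  assumes "compressed_monoidal_signature T"
  shows "wf_digraph (bang_typegraph T)"
proof -
  interpret wf_digraph "typegraph T" by (rule wf_typegraph[OF assms])
  have "tail (typegraph T) = tedge_tail T" "head (typegraph T) = tedge_head T"
    by (simp_all add: typegraph_def)
  then show ?thesis
    using tail_in_verts head_in_verts by unfold_locales (auto simp: bang_typegraph_def)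
qed

fun fixed_tedge :: "('o, 'm) tedge \<Rightarrow> bool" where
  "fixed_tedge (InEdge a f i) \<longleftrightarrow> a = Fixed"
| "fixed_tedge (OutEdge a f j) \<longleftrightarrow> a = Fixed"
| "fixed_tedge _ \<longleftrightarrow> False"


section \<open>Typed graphs and their morphisms\<close>

record ('v, 'e, 'w, 'f) gmap =
  vmap :: "'v \<Rightarrow> 'w"
  emap :: "'e \<Rightarrow> 'f"

definition graph_hom ::
  "('v, 'e) pre_digraph \<Rightarrow> ('w, 'f) pre_digraph \<Rightarrow> ('v, 'e, 'w, 'f) gmap \<Rightarrow> bool" where
  "graph_hom G H f \<longleftrightarrow>
     (\<forall>v \<in> verts G. vmap f v \<in> verts H) \<and>
     (\<forall>e \<in> arcs G. emap f e \<in> arcs H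
        \<and> tail H (emap f e) = vmap f (tail G e) \<and> head H (emap f e) = vmap f (head G e))"

definition gcomp ::
  "('w, 'f, 'x, 'g) gmap \<Rightarrow> ('v, 'e, 'w, 'f) gmap \<Rightarrow> ('v, 'e, 'x, 'g) gmap"  (infixl \<open>\<circ>\<^sub>g\<close> 55) where
  "g \<circ>\<^sub>g f = \<lparr> vmap = vmap g \<circ> vmap f, emap = emap g \<circ> emap f \<rparr>"

text \<open>Subgraphs live on the same types as the ambient graph, so all inclusions are the identity.\<close>

definition incl :: "('v, 'e, 'v, 'e) gmap" where
  "incl = \<lparr> vmap = id, emap = id \<rparr>"

record ('v, 'e, 'o, 'm) tgraph =
  under :: "('v, 'e) pre_digraph"
  typing :: "('v, 'e, ('o, 'm) tvert, ('o, 'm) tedge) gmap"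

abbreviation tverts :: "('v, 'e, 'o, 'm) tgraph \<Rightarrow> 'v set" where
  "tverts G \<equiv> verts (under G)"

abbreviation tarcs :: "('v, 'e, 'o, 'm) tgraph \<Rightarrow> 'e set" where
  "tarcs G \<equiv> arcs (under G)"

abbreviation vtype :: "('v, 'e, 'o, 'm) tgraph \<Rightarrow> 'v \<Rightarrow> ('o, 'm) tvert" where
  "vtype G \<equiv> vmap (typing G)"

abbreviation etype :: "('v, 'e, 'o, 'm) tgraph \<Rightarrow> 'e \<Rightarrow> ('o, 'm) tedge" where
  "etype G \<equiv> emap (typing G)"

definition typed_graph ::
  "(('o, 'm) tvert, ('o, 'm) tedge) pre_digraph \<Rightarrow> ('v, 'e, 'o, 'm) tgraph \<Rightarrow> bool" where
  "typed_graph TG G \<longleftrightarrow> fin_digraph (under G) \<and> graph_hom (under G) TG (typing G)"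

text \<open>Morphisms are total HOL functions; only their values on the domain graph are relevant.\<close>

definition mor_eq ::
  "('v, 'e, 'o, 'm) tgraph \<Rightarrow> ('v, 'e, 'w, 'f) gmap \<Rightarrow> ('v, 'e, 'w, 'f) gmap \<Rightarrow> bool" where
  "mor_eq G f g \<longleftrightarrow>
     (\<forall>v \<in> tverts G. vmap f v = vmap g v) \<and> (\<forall>e \<in> tarcs G. emap f e = emap g e)"

definition is_mor ::
  "('v, 'e, 'o, 'm) tgraph \<Rightarrow> ('w, 'f, 'o, 'm) tgraph \<Rightarrow> ('v, 'e, 'w, 'f) gmap \<Rightarrow> bool" where
  "is_mor G H f \<longleftrightarrow> graph_hom (under G) (under H) f \<and> mor_eq G (typing H \<circ>\<^sub>g f) (typing G)"

definition is_iso ::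
  "('v, 'e, 'o, 'm) tgraph \<Rightarrow> ('w, 'f, 'o, 'm) tgraph \<Rightarrow> ('v, 'e, 'w, 'f) gmap \<Rightarrow> bool" where
  "is_iso G H f \<longleftrightarrow> is_mor G H f \<and>
     (\<exists>g. is_mor H G g \<and> mor_eq G (g \<circ>\<^sub>g f) incl \<and> mor_eq H (f \<circ>\<^sub>g g) incl)"

definition typed_subgraph ::
  "('v, 'e, 'o, 'm) tgraph \<Rightarrow> ('v, 'e, 'o, 'm) tgraph \<Rightarrow> bool" where
  "typed_subgraph S G \<longleftrightarrow> subgraph (under S) (under G) \<and> mor_eq S (typing S) (typing G)"

definition full_subgraph ::
  "('v, 'e, 'o, 'm) tgraph \<Rightarrow> 'v set \<Rightarrow> ('v, 'e, 'o, 'm) tgraph" where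
  "full_subgraph G V = G\<lparr> under := under G \<restriction> V \<rparr>"

definition remove_verts ::
  "('v, 'e, 'o, 'm) tgraph \<Rightarrow> 'v set \<Rightarrow> ('v, 'e, 'o, 'm) tgraph" where
  "remove_verts G V = full_subgraph G (tverts G - V)"

definition restrict_mor ::
  "('v, 'e, 'o, 'm) tgraph \<Rightarrow> ('v, 'e, 'w, 'f) gmap \<Rightarrow> ('v, 'e, 'w, 'f) gmap" where
  "restrict_mor S f = \<lparr> vmap = restrict (vmap f) (tverts S), emap = restrict (emap f) (tarcs S) \<rparr>"


section \<open>String graphs\<close>

definition wire_verts :: "('v, 'e, 'o, 'm) tgraph \<Rightarrow> 'v set" where
  "wire_verts G = {v \<in> tverts G. \<exists>X. vtype G v = Obj X}"

definition node_verts :: "('v, 'e, 'o, 'm) tgraph \<Rightarrow> 'v set" where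
  "node_verts G = {v \<in> tverts G. \<exists>f. vtype G v = Mor f}"

definition bang_verts :: "('v, 'e, 'o, 'm) tgraph \<Rightarrow> 'v set" where
  "bang_verts G = {v \<in> tverts G. vtype G v = Bang}"

definition incident_arcs :: "('v, 'e) pre_digraph \<Rightarrow> 'v \<Rightarrow> 'e set" where
  "incident_arcs G v = in_arcs G v \<union> out_arcs G v"

definition string_graph :: "('o, 'm) signature \<Rightarrow> ('v, 'e, 'o, 'm) tgraph \<Rightarrow> bool" where
  "string_graph T G \<longleftrightarrow> typed_graph (typegraph T) G \<and>
     (\<forall>n \<in> node_verts G.
        bij_betw (etype G)
          {e \<in> incident_arcs (under G) n. fixed_tedge (etype G e)}
          {t \<in> incident_arcs (typegraph T) (vtype G n). fixed_tedge t}) \<and>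
     (\<forall>w \<in> wire_verts G. in_degree (under G) w \<le> 1 \<and> out_degree (under G) w \<le> 1)"

definition inputs :: "('v, 'e, 'o, 'm) tgraph \<Rightarrow> 'v set" where
  "inputs G = {w \<in> wire_verts G. in_arcs (under G) w = {}}"

definition outputs :: "('v, 'e, 'o, 'm) tgraph \<Rightarrow> 'v set" where
  "outputs G = {w \<in> wire_verts G. out_arcs (under G) w = {}}"

definition isolated_wires :: "('v, 'e, 'o, 'm) tgraph \<Rightarrow> 'v set" where
  "isolated_wires G = {w \<in> wire_verts G. incident_arcs (under G) w = {}}"

definition adjacent :: "('v, 'e) pre_digraph \<Rightarrow> 'v \<Rightarrow> 'v \<Rightarrow> bool" where
  "adjacent G v w \<longleftrightarrow> (v, w) \<in> arcs_ends G \<or> (w, v) \<in> arcs_ends G"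

definition open_subgraph ::
  "('o, 'm) signature \<Rightarrow> ('v, 'e, 'o, 'm) tgraph \<Rightarrow> ('v, 'e, 'o, 'm) tgraph \<Rightarrow> bool" where
  "open_subgraph T S K \<longleftrightarrow> string_graph T S \<and> typed_subgraph S K \<and>
     (\<forall>v \<in> tverts S. \<forall>w \<in> wire_verts K - tverts S. \<not> adjacent (under K) v w) \<and>
     (\<forall>v \<in> tverts S. \<forall>e \<in> incident_arcs (under K) v. fixed_tedge (etype K e) \<longrightarrow> e \<in> tarcs S)"


section \<open>!-graphs\<close>

definition U_part :: "('v, 'e, 'o, 'm) tgraph \<Rightarrow> ('v, 'e, 'o, 'm) tgraph" where
  "U_part G = remove_verts G (bang_verts G)"

definition bang_part :: "('v, 'e, 'o, 'm) tgraph \<Rightarrow> ('v, 'e, 'o, 'm) tgraph" where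
  "bang_part G = full_subgraph G (bang_verts G)"

definition bang_box :: "('v, 'e, 'o, 'm) tgraph \<Rightarrow> 'v \<Rightarrow> ('v, 'e, 'o, 'm) tgraph" where
  "bang_box G b = full_subgraph G {v. (b, v) \<in> arcs_ends (under G)}"

definition posetal :: "('v, 'e) pre_digraph \<Rightarrow> bool" where
  "posetal G \<longleftrightarrow> nomulti_digraph G \<and> partial_order_on (verts G) (arcs_ends G)"

definition bang_graph :: "('o, 'm) signature \<Rightarrow> ('v, 'e, 'o, 'm) tgraph \<Rightarrow> bool" where
  "bang_graph T G \<longleftrightarrow> typed_graph (bang_typegraph T) G \<and>
     string_graph T (U_part G) \<and>
     posetal (under (bang_part G)) \<and>
     (\<forall>b \<in> bang_verts G. open_subgraph T (U_part (bang_box G b)) (U_part G)) \<and>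
     (\<forall>b \<in> bang_verts G. \<forall>b' \<in> bang_verts (bang_box G b).
        typed_subgraph (bang_box G b') (bang_box G b))"

definition In_bang :: "('v, 'e, 'o, 'm) tgraph \<Rightarrow> ('v, 'e, 'o, 'm) tgraph" where
  "In_bang G = full_subgraph G (bang_verts G \<union> inputs (U_part G))"

definition Out_bang :: "('v, 'e, 'o, 'm) tgraph \<Rightarrow> ('v, 'e, 'o, 'm) tgraph" where
  "Out_bang G = full_subgraph G (bang_verts G \<union> outputs (U_part G))"

definition Bound_bang :: "('v, 'e, 'o, 'm) tgraph \<Rightarrow> ('v, 'e, 'o, 'm) tgraph" where
  "Bound_bang G =
     (let V = bang_verts G \<union> inputs (U_part G) \<union> outputs (U_part G) in
      G\<lparr> under := \<lparr> verts = V,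
                    arcs = {e \<in> tarcs G. tail (under G) e \<in> bang_verts G \<and> head (under G) e \<in> V},
                    tail = tail (under G),
                    head = head (under G) \<rparr> \<rparr>)"

definition monic :: "('v, 'e, 'o, 'm) tgraph \<Rightarrow> ('v, 'e, 'w, 'f) gmap \<Rightarrow> bool" where
  "monic G f \<longleftrightarrow> inj_on (vmap f) (tverts G) \<and> inj_on (emap f) (tarcs G)"

definition reflects_bang_boxes ::
  "('v, 'e, 'o, 'm) tgraph \<Rightarrow> ('w, 'f, 'o, 'm) tgraph \<Rightarrow> ('v, 'e, 'w, 'f) gmap \<Rightarrow> bool" where
  "reflects_bang_boxes G H f \<longleftrightarrow>
     (\<forall>e \<in> tarcs H. tail (under H) e \<in> bang_verts H \<and> head (under H) e \<in> vmap f ` tverts G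
        \<longrightarrow> e \<in> emap f ` tarcs G)"


section \<open>The pushout of two copies of a graph along a subgraph\<close>

text \<open>
  The pushout of \<open>G \<hookleftarrow> S \<hookrightarrow> G\<close> for a subgraph \<open>S\<close> of \<open>G\<close>: elements of the first copy are tagged
  \<^const>\<open>False\<close>; those of the second copy are tagged \<^const>\<open>True\<close> unless they lie in \<open>S\<close>, where they
  are identified with the first copy. The lemmas below establish the universal property in the
  category of typed graphs.
\<close>

definition coproj1 :: "('v, 'e, 'o, 'm) tgraph \<Rightarrow> ('v, 'e, 'v \<times> bool, 'e \<times> bool) gmap" where
  "coproj1 S = \<lparr> vmap = \<lambda>v. (v, False), emap = \<lambda>e. (e, False) \<rparr>"

definition coproj2 :: "('v, 'e, 'o, 'm) tgraph \<Rightarrow> ('v, 'e, 'v \<times> bool, 'e \<times> bool) gmap" where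
  "coproj2 S = \<lparr> vmap = \<lambda>v. (v, v \<notin> tverts S), emap = \<lambda>e. (e, e \<notin> tarcs S) \<rparr>"

definition self_pushout ::
  "('v, 'e, 'o, 'm) tgraph \<Rightarrow> ('v, 'e, 'o, 'm) tgraph \<Rightarrow> ('v \<times> bool, 'e \<times> bool, 'o, 'm) tgraph" where
  "self_pushout G S =
     \<lparr> under =
         \<lparr> verts = vmap (coproj1 S) ` tverts G \<union> vmap (coproj2 S) ` tverts G,
           arcs = emap (coproj1 S) ` tarcs G \<union> emap (coproj2 S) ` tarcs G,
           tail = (\<lambda>(e, k). vmap (if k then coproj2 S else coproj1 S) (tail (under G) e)),
           head = (\<lambda>(e, k). vmap (if k then coproj2 S else coproj1 S) (head (under G) e)) \<rparr>,
       typing = \<lparr> vmap = (\<lambda>(v, k). vtype G v), emap = (\<lambda>(e, k). etype G e) \<rparr> \<rparr>"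

definition cotuple ::
  "('v, 'e, 'w, 'f) gmap \<Rightarrow> ('v, 'e, 'w, 'f) gmap \<Rightarrow> ('v \<times> bool, 'e \<times> bool, 'w, 'f) gmap" where
  "cotuple g1 g2 =
     \<lparr> vmap = (\<lambda>(v, k). vmap (if k then g2 else g1) v),
       emap = (\<lambda>(e, k). emap (if k then g2 else g1) e) \<rparr>"

lemmas self_pushout_simps =
  coproj1_def coproj2_def self_pushout_def cotuple_def

lemma typed_subgraphD:
  assumes "typed_subgraph S G"
  shows "tverts S \<subseteq> tverts G" "tarcs S \<subseteq> tarcs G"
    "\<And>e. e \<in> tarcs S \<Longrightarrow> tail (under G) e \<in> tverts S"
    "\<And>e. e \<in> tarcs S \<Longrightarrow> head (under G) e \<in> tverts S"
    "\<And>e. e \<in> tarcs G \<Longrightarrow> tail (under G) e \<in> tverts G"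
    "\<And>e. e \<in> tarcs G \<Longrightarrow> head (under G) e \<in> tverts G"
  using assms
  unfolding typed_subgraph_def subgraph_def compatible_def wf_digraph_def by auto

lemma typed_graph_self_pushout:
  assumes "typed_graph TG G" "typed_subgraph S G"
  shows "typed_graph TG (self_pushout G S)"
  using assms(1) typed_subgraphD[OF assms(2)]
  unfolding typed_graph_def graph_hom_def fin_digraph_def fin_digraph_axioms_def wf_digraph_def
  by (auto simp: self_pushout_simps)

lemma is_mor_coproj:
  assumes "typed_subgraph S G"
  shows "is_mor G (self_pushout G S) (coproj1 S)"
    and "is_mor G (self_pushout G S) (coproj2 S)"
  using typed_subgraphD[OF assms]
  by (auto simp: is_mor_def graph_hom_def mor_eq_def gcomp_def self_pushout_simps)

lemma coproj_commute: "mor_eq S (coproj1 S) (coproj2 S)"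
  by (simp add: mor_eq_def coproj1_def coproj2_def)

theorem self_pushout_universal:
  assumes S: "typed_subgraph S G"
    and g: "is_mor G H g1" "is_mor G H g2" "mor_eq S g1 g2"
  shows "is_mor (self_pushout G S) H (cotuple g1 g2)"
    and "mor_eq G (cotuple g1 g2 \<circ>\<^sub>g coproj1 S) g1"
    and "mor_eq G (cotuple g1 g2 \<circ>\<^sub>g coproj2 S) g2"
    and "\<And>h. \<lbrakk> is_mor (self_pushout G S) H h;
           mor_eq G (h \<circ>\<^sub>g coproj1 S) g1; mor_eq G (h \<circ>\<^sub>g coproj2 S) g2 \<rbrakk>
         \<Longrightarrow> mor_eq (self_pushout G S) h (cotuple g1 g2)"
  using g typed_subgraphD[OF S]
  by (auto simp: is_mor_def graph_hom_def mor_eq_def gcomp_def self_pushout_simps)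


section \<open>Operations on !-boxes\<close>

definition DROP :: "'v \<Rightarrow> ('v, 'e, 'o, 'm) tgraph \<Rightarrow> ('v, 'e, 'o, 'm) tgraph" where
  "DROP b G = remove_verts G {b}"

definition KILL :: "'v \<Rightarrow> ('v, 'e, 'o, 'm) tgraph \<Rightarrow> ('v, 'e, 'o, 'm) tgraph" where
  "KILL b G = remove_verts G (tverts (bang_box G b))"

definition COPY :: "'v \<Rightarrow> ('v, 'e, 'o, 'm) tgraph \<Rightarrow> ('v \<times> bool, 'e \<times> bool, 'o, 'm) tgraph" where
  "COPY b G = self_pushout G (remove_verts G (tverts (bang_box G b)))"

definition copy_proj1 ::
  "'v \<Rightarrow> ('v, 'e, 'o, 'm) tgraph \<Rightarrow> ('v, 'e, 'v \<times> bool, 'e \<times> bool) gmap" where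
  "copy_proj1 b G = coproj1 (remove_verts G (tverts (bang_box G b)))"

definition copy_proj2 ::
  "'v \<Rightarrow> ('v, 'e, 'o, 'm) tgraph \<Rightarrow> ('v, 'e, 'v \<times> bool, 'e \<times> bool) gmap" where
  "copy_proj2 b G = coproj2 (remove_verts G (tverts (bang_box G b)))"

text \<open>
  The actions of the operations at \<open>b\<close> and \<open>f b\<close> on a morphism \<open>f\<close> from \<open>G\<close> to \<open>H\<close>, meaningful
  when \<open>f\<close> is monic and reflects !-box containment.
\<close>

definition DROP_mor ::
  "'v \<Rightarrow> ('v, 'e, 'o, 'm) tgraph \<Rightarrow> ('v, 'e, 'w, 'f) gmap \<Rightarrow> ('v, 'e, 'w, 'f) gmap" where
  "DROP_mor b G f = restrict_mor (DROP b G) f"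

definition KILL_mor ::
  "'v \<Rightarrow> ('v, 'e, 'o, 'm) tgraph \<Rightarrow> ('v, 'e, 'w, 'f) gmap \<Rightarrow> ('v, 'e, 'w, 'f) gmap" where
  "KILL_mor b G f = restrict_mor (KILL b G) f"

definition COPY_mor ::
  "'v \<Rightarrow> ('w, 'f, 'o, 'm) tgraph \<Rightarrow> ('v, 'e, 'w, 'f) gmap
     \<Rightarrow> ('v \<times> bool, 'e \<times> bool, 'w \<times> bool, 'f \<times> bool) gmap" where
  "COPY_mor b H f = cotuple (copy_proj1 (vmap f b) H \<circ>\<^sub>g f) (copy_proj2 (vmap f b) H \<circ>\<^sub>g f)"

lemma typed_subgraph_full:
  assumes "wf_digraph (under G)" "V \<subseteq> tverts G"
  shows "typed_subgraph (full_subgraph G V) G"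
  using assms
  by (auto simp: typed_subgraph_def full_subgraph_def mor_eq_def subgraph_def compatible_def
      wf_digraph_def)

lemma is_mor_gcomp: "is_mor G H f \<Longrightarrow> is_mor H K g \<Longrightarrow> is_mor G K (g \<circ>\<^sub>g f)"
  by (auto simp: is_mor_def graph_hom_def mor_eq_def gcomp_def)

lemma bang_box_reflect:
  assumes f: "is_mor G H f" "monic G f" "reflects_bang_boxes G H f"
    and G: "wf_digraph (under G)" and b: "b \<in> bang_verts G" and v: "v \<in> tverts G"
    and fv: "vmap f v \<in> tverts (bang_box H (vmap f b))"
  shows "v \<in> tverts (bang_box G b)"
proof -
  from fv obtain e where e: "e \<in> tarcs H" "tail (under H) e = vmap f b" "head (under H) e = vmap f v"
    by (auto simp: bang_box_def full_subgraph_def arcs_ends_def arc_to_ends_def)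
  have "vmap f b \<in> bang_verts H"
    using f(1) b by (auto simp: is_mor_def graph_hom_def mor_eq_def gcomp_def bang_verts_def)
  with e v f(3) obtain e' where e': "e' \<in> tarcs G" "e = emap f e'"
    by (auto simp: reflects_bang_boxes_def)
  have "vmap f (tail (under G) e') = vmap f b" "vmap f (head (under G) e') = vmap f v"
    using e e' f(1) by (auto simp: is_mor_def graph_hom_def)
  moreover have "tail (under G) e' \<in> tverts G" "head (under G) e' \<in> tverts G"
    using e' G by (auto simp: wf_digraph_def)
  ultimately have "tail (under G) e' = b" "head (under G) e' = v"
    using f(2) b v by (auto simp: monic_def bang_verts_def dest: inj_onD)
  with e' show ?thesis
    by (auto simp: bang_box_def full_subgraph_def arcs_ends_def arc_to_ends_def)
qed

theorem COPY_mor_unique: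
  assumes f: "is_mor G H f" "monic G f" "reflects_bang_boxes G H f"
    and G: "wf_digraph (under G)" and H: "wf_digraph (under H)" and b: "b \<in> bang_verts G"
  shows "is_mor (COPY b G) (COPY (vmap f b) H) (COPY_mor b H f)"
    and "mor_eq G (COPY_mor b H f \<circ>\<^sub>g copy_proj1 b G) (copy_proj1 (vmap f b) H \<circ>\<^sub>g f)"
    and "mor_eq G (COPY_mor b H f \<circ>\<^sub>g copy_proj2 b G) (copy_proj2 (vmap f b) H \<circ>\<^sub>g f)"
    and "\<And>h. \<lbrakk> is_mor (COPY b G) (COPY (vmap f b) H) h;
           mor_eq G (h \<circ>\<^sub>g copy_proj1 b G) (copy_proj1 (vmap f b) H \<circ>\<^sub>g f);
           mor_eq G (h \<circ>\<^sub>g copy_proj2 b G) (copy_proj2 (vmap f b) H \<circ>\<^sub>g f) \<rbrakk>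
         \<Longrightarrow> mor_eq (COPY b G) h (COPY_mor b H f)"
proof -
  let ?S = "remove_verts G (tverts (bang_box G b))"
  let ?S' = "remove_verts H (tverts (bang_box H (vmap f b)))"
  have S: "typed_subgraph ?S G" and S': "typed_subgraph ?S' H"
    using G H by (auto simp: remove_verts_def intro!: typed_subgraph_full)
  have m1: "is_mor G (COPY (vmap f b) H) (copy_proj1 (vmap f b) H \<circ>\<^sub>g f)"
    and m2: "is_mor G (COPY (vmap f b) H) (copy_proj2 (vmap f b) H \<circ>\<^sub>g f)"
    using is_mor_gcomp[OF f(1)] is_mor_coproj[OF S']
    by (auto simp: COPY_def copy_proj1_def copy_proj2_def)
  have "\<And>v. v \<in> tverts ?S \<Longrightarrow> vmap f v \<in> tverts ?S'"
    using bang_box_reflect[OF f G b] f(1)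
    by (auto simp: remove_verts_def full_subgraph_def is_mor_def graph_hom_def)
  then have "mor_eq ?S (copy_proj1 (vmap f b) H \<circ>\<^sub>g f) (copy_proj2 (vmap f b) H \<circ>\<^sub>g f)"
    using f(1)
    by (auto simp: mor_eq_def gcomp_def copy_proj1_def copy_proj2_def coproj1_def coproj2_def
        is_mor_def graph_hom_def remove_verts_def full_subgraph_def)
  note * = self_pushout_universal[OF S m1 m2 this,
      folded COPY_def[of b G] copy_proj2_def[of b G] copy_proj1_def[of b G] COPY_mor_def[of b H f]]
  show "is_mor (COPY b G) (COPY (vmap f b) H) (COPY_mor b H f)"
    by (rule *(1))
  show "mor_eq G (COPY_mor b H f \<circ>\<^sub>g copy_proj1 b G) (copy_proj1 (vmap f b) H \<circ>\<^sub>g f)"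
    by (rule *(2))
  show "mor_eq G (COPY_mor b H f \<circ>\<^sub>g copy_proj2 b G) (copy_proj2 (vmap f b) H \<circ>\<^sub>g f)"
    by (rule *(3))
  show "mor_eq (COPY b G) h (COPY_mor b H f)"
    if "is_mor (COPY b G) (COPY (vmap f b) H) h"
      "mor_eq G (h \<circ>\<^sub>g copy_proj1 b G) (copy_proj1 (vmap f b) H \<circ>\<^sub>g f)"
      "mor_eq G (h \<circ>\<^sub>g copy_proj2 b G) (copy_proj2 (vmap f b) H \<circ>\<^sub>g f)" for h
    using that by (rule *(4))
qed


section \<open>!-graph equations\<close>

definition bang_graph_equation ::
  "('o, 'm) signature \<Rightarrow> ('v1, 'e1, 'o, 'm) tgraph \<Rightarrow> ('v, 'e, 'o, 'm) tgraph
     \<Rightarrow> ('v2, 'e2, 'o, 'm) tgraph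
     \<Rightarrow> ('v, 'e, 'v1, 'e1) gmap \<Rightarrow> ('v, 'e, 'v2, 'e2) gmap \<Rightarrow> bool" where
  "bang_graph_equation T L I R i1 i2 \<longleftrightarrow>
     bang_graph T L \<and> bang_graph T I \<and> bang_graph T R \<and> is_mor I L i1 \<and> is_mor I R i2 \<and>
     isolated_wires (U_part L) = {} \<and> isolated_wires (U_part R) = {} \<and>
     (\<exists>\<phi>I \<phi>O \<phi>L \<phi>R.
        is_iso (In_bang L) (In_bang R) \<phi>I \<and> is_iso (Out_bang L) (Out_bang R) \<phi>O \<and>
        is_iso (Bound_bang L) I \<phi>L \<and> is_iso (Bound_bang R) I \<phi>R \<and>
        (let j1 = \<phi>L \<circ>\<^sub>g incl; j2 = \<phi>R \<circ>\<^sub>g incl in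
           mor_eq (In_bang L) (i1 \<circ>\<^sub>g j1) incl \<and> mor_eq (In_bang R) (i2 \<circ>\<^sub>g j2) incl \<and>
           mor_eq (In_bang L) (j2 \<circ>\<^sub>g \<phi>I) j1) \<and>
        (let k1 = \<phi>L \<circ>\<^sub>g incl; k2 = \<phi>R \<circ>\<^sub>g incl in
           mor_eq (Out_bang L) (i1 \<circ>\<^sub>g k1) incl \<and> mor_eq (Out_bang R) (i2 \<circ>\<^sub>g k2) incl \<and>
           mor_eq (Out_bang L) (k2 \<circ>\<^sub>g \<phi>O) k1))"

lemma boundary_leg:
  assumes phi: "is_iso (Bound_bang G) I \<phi>"
    and inp: "mor_eq (In_bang G) (i \<circ>\<^sub>g (\<phi> \<circ>\<^sub>g incl)) incl"
    and outp: "mor_eq (Out_bang G) (i \<circ>\<^sub>g (\<phi> \<circ>\<^sub>g incl)) incl"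
  shows "monic I i \<and> reflects_bang_boxes I G i"
proof -
  from phi obtain g where \<phi>: "is_mor (Bound_bang G) I \<phi>" and g: "is_mor I (Bound_bang G) g"
    and \<phi>g: "mor_eq I (\<phi> \<circ>\<^sub>g g) incl"
    by (auto simp: is_iso_def)
  have v: "vmap i (vmap \<phi> x) = x" if "x \<in> tverts (Bound_bang G)" for x
    using that inp outp
    by (auto simp: Bound_bang_def In_bang_def Out_bang_def full_subgraph_def mor_eq_def gcomp_def
        incl_def Let_def)
  have e: "emap i (emap \<phi> x) = x" if "x \<in> tarcs (Bound_bang G)" for x
    using that inp outp
    by (auto simp: Bound_bang_def In_bang_def Out_bang_def full_subgraph_def mor_eq_def gcomp_def
        incl_def Let_def)
  have gB: "vmap g x \<in> tverts (Bound_bang G)" "vmap \<phi> (vmap g x) = x" if "x \<in> tverts I" for x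
    using g \<phi>g that by (auto simp: is_mor_def graph_hom_def mor_eq_def gcomp_def incl_def)
  have gE: "emap g x \<in> tarcs (Bound_bang G)" "emap \<phi> (emap g x) = x" if "x \<in> tarcs I" for x
    using g \<phi>g that by (auto simp: is_mor_def graph_hom_def mor_eq_def gcomp_def incl_def)
  have iv: "vmap i x = vmap g x" if "x \<in> tverts I" for x
    using v[OF gB(1)[OF that]] gB(2)[OF that] by simp
  have ie: "emap i x = emap g x" if "x \<in> tarcs I" for x
    using e[OF gE(1)[OF that]] gE(2)[OF that] by simp
  have "monic I i"
    unfolding monic_def
  proof
    show "inj_on (vmap i) (tverts I)"
      by (rule inj_on_inverseI[of _ "vmap \<phi>"]) (simp only: iv gB(2))
    show "inj_on (emap i) (tarcs I)"
      by (rule inj_on_inverseI[of _ "emap \<phi>"]) (simp only: ie gE(2))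
  qed
  moreover have "x \<in> emap i ` tarcs I"
    if x: "x \<in> tarcs G" "tail (under G) x \<in> bang_verts G" "head (under G) x \<in> vmap i ` tverts I" for x
  proof -
    from x(3) obtain y where "y \<in> tverts I" "head (under G) x = vmap i y" by blast
    then have "head (under G) x \<in> tverts (Bound_bang G)"
      by (simp only: iv gB(1))
    with x(1,2) have xB: "x \<in> tarcs (Bound_bang G)"
      by (simp add: Bound_bang_def Let_def)
    then have "emap \<phi> x \<in> tarcs I"
      using \<phi> by (simp add: is_mor_def graph_hom_def)
    with e[OF xB, symmetric] show ?thesis
      by (rule image_eqI)
  qed
  ultimately show ?thesis
    unfolding reflects_bang_boxes_def by blast
qed

lemma bang_graph_equation_legs:
  assumes "bang_graph_equation T L I R i1 i2"
  shows "monic I i1 \<and> reflects_bang_boxes I L i1" "monic I i2 \<and> reflects_bang_boxes I R i2"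
proof -
  from assms obtain \<phi>L \<phi>R where
    L: "is_iso (Bound_bang L) I \<phi>L" "mor_eq (In_bang L) (i1 \<circ>\<^sub>g (\<phi>L \<circ>\<^sub>g incl)) incl"
      "mor_eq (Out_bang L) (i1 \<circ>\<^sub>g (\<phi>L \<circ>\<^sub>g incl)) incl"
    and R: "is_iso (Bound_bang R) I \<phi>R" "mor_eq (In_bang R) (i2 \<circ>\<^sub>g (\<phi>R \<circ>\<^sub>g incl)) incl"
      "mor_eq (Out_bang R) (i2 \<circ>\<^sub>g (\<phi>R \<circ>\<^sub>g incl)) incl"
    unfolding bang_graph_equation_def Let_def by (elim conjE exE) rule
  show "monic I i1 \<and> reflects_bang_boxes I L i1" using L by (rule boundary_leg)
  show "monic I i2 \<and> reflects_bang_boxes I R i2" using R by (rule boundary_leg)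
qed

end

theory Submission
  imports Defs
begin

text \<open>
  A !-graph equation amounts to two bijections \<open>i\<^sub>1\<close>, \<open>i\<^sub>2\<close> of \<open>I\<close> onto the boundaries of \<open>L\<close> and
  \<open>R\<close> under which inputs correspond to inputs and outputs to outputs: the required isomorphisms
  are then the inverses of the legs and \<open>i\<^sub>2 \<circ> i\<^sub>1\<inverse>\<close>. Since !-boxes are open, a wire-vertex
  outside a box has all its neighbours in the underlying string graph outside the box. Hence
  a surviving or copied wire-vertex keeps its in- and out-degree under each operation, so
  the operations commute with taking the boundary. As the legs reflect !-box containment, the
  bijections restrict (DROP, KILL) or extend (COPY) accordingly.
\<close>

section \<open>Elementwise description of !-graphs\<close>

text \<open>The definitions stack full subgraphs on one another, such as
  \<open>U_part (bang_box G b)\<close> inside \<open>U_part G\<close>, and such stacks are hard to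
  follow through an operation. The conditions are therefore restated on vertices and arcs of
  \<open>G\<close> itself, and degree bounds are replaced by uniqueness of arcs.

  An arc that crosses the border of an open set has variable arity, its inner end is a wire-vertex
  and its outer end a node-vertex. Removing the set thus costs the outer nodes only arcs that no
  string-graph condition counts, and copying it gives them only further arcs of this kind.

  DROP and KILL are both the removal of an open set of vertices, \<open>{b}\<close> and the box of
  \<open>b\<close>, and share their lemmas. COPY is treated separately: its elements are pairs with
  a tag, and the work lies in showing that tags agree, by openness for wiring arcs and by nesting of
  boxes for arcs between !-vertices.\<close>

abbreviation src :: "('v, 'e, 'o, 'm) tgraph \<Rightarrow> 'e \<Rightarrow> 'v" where
  "src G \<equiv> tail (under G)"

abbreviation tgt :: "('v, 'e, 'o, 'm) tgraph \<Rightarrow> 'e \<Rightarrow> 'v" where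
  "tgt G \<equiv> head (under G)"

abbreviation box :: "('v, 'e, 'o, 'm) tgraph \<Rightarrow> 'v \<Rightarrow> 'v set" where
  "box G b \<equiv> tverts (bang_box G b)"

lemma full_subgraph_simps [simp]:
  "tverts (full_subgraph G V) = V"
  "tarcs (full_subgraph G V) = {e \<in> tarcs G. src G e \<in> V \<and> tgt G e \<in> V}"
  "src (full_subgraph G V) = src G"
  "tgt (full_subgraph G V) = tgt G"
  "typing (full_subgraph G V) = typing G"
  by (simp_all add: full_subgraph_def)

lemma full_subgraph_full_subgraph:
  "W \<subseteq> V \<Longrightarrow> full_subgraph (full_subgraph G V) W = full_subgraph G W"
proof -
  assume "W \<subseteq> V"
  then have "{e \<in> tarcs G. (src G e \<in> V \<and> tgt G e \<in> V) \<and> src G e \<in> W \<and> tgt G e \<in> W}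
      = {e \<in> tarcs G. src G e \<in> W \<and> tgt G e \<in> W}"
    by auto
  then show ?thesis
    by (simp add: full_subgraph_def induce_subgraph_def)
qed

lemma in_box_iff: "v \<in> box G b \<longleftrightarrow> (\<exists>e \<in> tarcs G. src G e = b \<and> tgt G e = v)"
  by (auto simp: bang_box_def arcs_ends_def arc_to_ends_def)

lemma typed_graphD:
  assumes "typed_graph TG G"
  shows "e \<in> tarcs G \<Longrightarrow> src G e \<in> tverts G"
    and "e \<in> tarcs G \<Longrightarrow> tgt G e \<in> tverts G"
    and "finite (tverts G)" "finite (tarcs G)" "wf_digraph (under G)"
    and "v \<in> tverts G \<Longrightarrow> vtype G v \<in> verts TG"
    and "e \<in> tarcs G \<Longrightarrow> etype G e \<in> arcs TG"
    and "e \<in> tarcs G \<Longrightarrow> vtype G (src G e) = tail TG (etype G e)"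
    and "e \<in> tarcs G \<Longrightarrow> vtype G (tgt G e) = head TG (etype G e)"
  using assms
  by (auto simp: typed_graph_def graph_hom_def fin_digraph_def fin_digraph_axioms_def
      wf_digraph_def)

section \<open>Arcs of the underlying string graph, and open sets of vertices\<close>

text \<open>These are the arcs of U(G). A condition on the source is enough, because in a typed
  graph no arc leads from a wire- or node-vertex to a !-vertex.\<close>

definition wiring_arcs :: "('v, 'e, 'o, 'm) tgraph \<Rightarrow> 'e set" where
  "wiring_arcs G = {e \<in> tarcs G. src G e \<notin> bang_verts G}"

definition fixed_arcs :: "('v, 'e, 'o, 'm) tgraph \<Rightarrow> 'v \<Rightarrow> 'e set" where
  "fixed_arcs G n = {e \<in> tarcs G. (src G e = n \<or> tgt G e = n) \<and> fixed_tedge (etype G e)}"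

text \<open>
  Openness of the part of \<open>V\<close> outside the !-vertices; the condition forbids arcs between \<open>V\<close> and
  wire-vertices outside, so it is also what makes the removal of \<open>V\<close> harmless.
\<close>

definition wire_open :: "('v, 'e, 'o, 'm) tgraph \<Rightarrow> 'v set \<Rightarrow> bool" where
  "wire_open G V \<longleftrightarrow>
     (\<forall>e \<in> wiring_arcs G.
        (src G e \<in> V \<and> tgt G e \<in> wire_verts G \<longrightarrow> tgt G e \<in> V) \<and>
        (tgt G e \<in> V \<and> src G e \<in> wire_verts G \<longrightarrow> src G e \<in> V) \<and>
        (fixed_tedge (etype G e) \<longrightarrow> (src G e \<in> V \<longleftrightarrow> tgt G e \<in> V)))"

text \<open>The only typegraph edge with head \<open>Bang\<close> is \<open>BangLoop\<close>: each
  \<open>BangEdge x\<close> has \<open>x\<close> among the wire and node types.\<close>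

lemma tgt_bang_imp_src_bang:
  assumes "typed_graph (bang_typegraph T) G" "e \<in> tarcs G" "tgt G e \<in> bang_verts G"
  shows "src G e \<in> bang_verts G"
  using typed_graphD(1,7-)[OF assms(1,2)] assms(3)
  by (auto simp: bang_verts_def bang_typegraph_def typegraph_def)

lemma wiring_arcs_iff:
  assumes "typed_graph (bang_typegraph T) G"
  shows "e \<in> wiring_arcs G \<longleftrightarrow>
    e \<in> tarcs G \<and> src G e \<in> tverts G - bang_verts G \<and> tgt G e \<in> tverts G - bang_verts G"
  using typed_graphD(1,2)[OF assms] tgt_bang_imp_src_bang[OF assms]
  by (auto simp: wiring_arcs_def)

lemma fixed_imp_wiring:
  assumes "typed_graph (bang_typegraph T) G" "e \<in> tarcs G" "fixed_tedge (etype G e)"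
  shows "e \<in> wiring_arcs G"
  using assms(3) typed_graphD(8)[OF assms(1,2)] assms(2)
  by (cases "etype G e") (auto simp: wiring_arcs_def bang_verts_def bang_typegraph_def)

lemma typed_graph_full_subgraph:
  assumes "typed_graph (bang_typegraph T) G" "V \<subseteq> tverts G"
  shows "typed_graph (bang_typegraph T) (full_subgraph G V)"
  using assms
  by (auto simp: typed_graph_def graph_hom_def fin_digraph_def fin_digraph_axioms_def
      wf_digraph_def full_subgraph_def intro: finite_subset)

text \<open>Both kinds of edge that \<open>bang_typegraph T\<close> adds start at
  \<open>Bang\<close>, so away from the !-vertices the typing lands in
  \<open>typegraph T\<close>.\<close>

lemma typed_graph_wiring:
  assumes G: "typed_graph (bang_typegraph T) G" and V: "V \<subseteq> tverts G - bang_verts G"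
  shows "typed_graph (typegraph T) (full_subgraph G V)"
proof -
  have "vtype G v \<in> verts (typegraph T)" if "v \<in> V" for v
    using that V typed_graphD(6)[OF G, of v] by (auto simp: bang_typegraph_def bang_verts_def)
  moreover have "etype G e \<in> arcs (typegraph T)" if "e \<in> tarcs G" "src G e \<in> V" for e
    using that V typed_graphD(1,7,8)[OF G that(1)]
    by (auto simp: bang_typegraph_def bang_verts_def)
  moreover have "typed_graph (bang_typegraph T) (full_subgraph G V)"
    using V by (intro typed_graph_full_subgraph[OF G]) auto
  ultimately show ?thesis
    by (auto simp: typed_graph_def graph_hom_def bang_typegraph_def typegraph_def)
qed

text \<open>Degree at most 1 is traded for uniqueness of arcs, which passes to subgraphs and copies
  without counting. All conditions speak of arcs of \<open>G\<close> with both ends in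
  \<open>V\<close>, so that different \<open>V\<close> can be compared directly.\<close>

lemma string_graph_full_subgraph_iff:
  assumes G: "typed_graph (bang_typegraph T) G" and V: "V \<subseteq> tverts G - bang_verts G"
  shows "string_graph T (full_subgraph G V) \<longleftrightarrow>
    (\<forall>n \<in> node_verts G \<inter> V.
       bij_betw (etype G) {e \<in> fixed_arcs G n. src G e \<in> V \<and> tgt G e \<in> V}
         {t \<in> incident_arcs (typegraph T) (vtype G n). fixed_tedge t}) \<and>
    (\<forall>e \<in> tarcs G. \<forall>e' \<in> tarcs G.
       src G e \<in> V \<and> tgt G e \<in> V \<and> src G e' \<in> V \<and> tgt G e' \<in> V \<longrightarrow>
       (tgt G e = tgt G e' \<and> tgt G e \<in> wire_verts G \<longrightarrow> e = e') \<and>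
       (src G e = src G e' \<and> src G e \<in> wire_verts G \<longrightarrow> e = e'))"
proof -
  let ?S = "full_subgraph G V"
  have fin: "finite (in_arcs (under ?S) w)" "finite (out_arcs (under ?S) w)" for w
    using typed_graphD(4)[OF G] by (auto simp: in_arcs_def out_arcs_def)
  have nodes: "node_verts ?S = node_verts G \<inter> V" and wires: "wire_verts ?S = wire_verts G \<inter> V"
    using V by (auto simp: node_verts_def wire_verts_def)
  have fx: "{e \<in> incident_arcs (under ?S) n. fixed_tedge (etype ?S e)}
      = {e \<in> fixed_arcs G n. src G e \<in> V \<and> tgt G e \<in> V}" for n
    by (auto simp: incident_arcs_def fixed_arcs_def in_arcs_def out_arcs_def)
  have deg: "(in_degree (under ?S) w \<le> 1 \<and> out_degree (under ?S) w \<le> 1) \<longleftrightarrow>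
      (\<forall>e \<in> in_arcs (under ?S) w. \<forall>e' \<in> in_arcs (under ?S) w. e = e') \<and>
      (\<forall>e \<in> out_arcs (under ?S) w. \<forall>e' \<in> out_arcs (under ?S) w. e = e')" for w
    unfolding in_degree_def out_degree_def One_nat_def
    using fin by (simp add: card_le_Suc0_iff_eq)
  show ?thesis
    unfolding string_graph_def fx nodes wires deg
    using typed_graph_wiring[OF G V]
    by (auto simp: in_arcs_def out_arcs_def)
qed

lemma U_part_eq: "U_part G = full_subgraph G (tverts G - bang_verts G)"
  by (simp add: U_part_def remove_verts_def)

lemma U_part_bang_box:
  assumes "typed_graph (bang_typegraph T) G"
  shows "U_part (bang_box G b) = full_subgraph G (box G b - bang_verts G)"
proof -
  have "bang_box G b = full_subgraph G (box G b)"
    by (simp add: bang_box_def)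
  moreover have "bang_verts (bang_box G b) = box G b \<inter> bang_verts G"
    using typed_graphD(2)[OF assms] by (auto simp: bang_verts_def in_box_iff) (auto simp: bang_box_def)
  moreover have "full_subgraph (full_subgraph G (box G b)) (box G b - bang_verts G)
      = full_subgraph G (box G b - bang_verts G)"
    by (rule full_subgraph_full_subgraph) auto
  ultimately show ?thesis
    by (simp add: U_part_eq Diff_Int)
qed

text \<open>Openness also asks the part to be a string graph. This follows from
  \<open>wire_open\<close>: nodes inside keep all their fixed-arity arcs, and uniqueness of arcs at
  wire-vertices is inherited from \<open>U_part G\<close>.\<close>

lemma open_subgraph_full_iff:
  assumes G: "typed_graph (bang_typegraph T) G" and V: "V \<subseteq> tverts G"
    and str: "string_graph T (U_part G)"
  shows "open_subgraph T (full_subgraph G (V - bang_verts G)) (U_part G) \<longleftrightarrow> wire_open G V"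
proof -
  let ?W = "tverts G - bang_verts G" and ?V = "V - bang_verts G"
  let ?S = "full_subgraph G ?V" and ?K = "full_subgraph G ?W"
  note wiring = wiring_arcs_iff[OF G]
  have WV: "?W \<subseteq> tverts G - bang_verts G" "?V \<subseteq> tverts G - bang_verts G"
    using V by auto
  have sub: "typed_subgraph ?S ?K"
  proof -
    have "wf_digraph (under ?K)"
      by (rule typed_graphD(5)[OF typed_graph_wiring[OF G]]) auto
    then have "typed_subgraph (full_subgraph ?K ?V) ?K"
      using V by (intro typed_subgraph_full) auto
    then show ?thesis
      using WV(2) by (simp add: full_subgraph_full_subgraph)
  qed
  have wires: "wire_verts ?K = wire_verts G"
    by (auto simp: wire_verts_def bang_verts_def)
  have adj: "adjacent (under ?K) v w \<longleftrightarrow>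
      (\<exists>e \<in> wiring_arcs G. src G e = v \<and> tgt G e = w \<or> src G e = w \<and> tgt G e = v)" for v w
    by (force simp: adjacent_def arcs_ends_def arc_to_ends_def wiring)
  \<comment> \<open>Adjacency forgets direction, so it yields both directed closure clauses of
    \<open>wire_open\<close>.\<close>
  have adj_closed: "(\<forall>v \<in> ?V. \<forall>w \<in> wire_verts G - ?V. \<not> adjacent (under ?K) v w) \<longleftrightarrow>
      (\<forall>e \<in> wiring_arcs G.
        (src G e \<in> V \<and> tgt G e \<in> wire_verts G \<longrightarrow> tgt G e \<in> V) \<and>
        (tgt G e \<in> V \<and> src G e \<in> wire_verts G \<longrightarrow> src G e \<in> V))"
    (is "?L \<longleftrightarrow> ?R")
  proof
    assume L: ?L
    show ?R
    proof (intro ballI conjI impI; elim conjE)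
      fix e assume e: "e \<in> wiring_arcs G"
      then have nb: "src G e \<notin> bang_verts G" "tgt G e \<notin> bang_verts G"
        by (auto simp: wiring)
      have "adjacent (under ?K) (src G e) (tgt G e)" "adjacent (under ?K) (tgt G e) (src G e)"
        unfolding adj using e by auto
      with L nb show "tgt G e \<in> V" if "src G e \<in> V" "tgt G e \<in> wire_verts G"
        using that by blast
      from L nb \<open>adjacent (under ?K) (tgt G e) (src G e)\<close>
      show "src G e \<in> V" if "tgt G e \<in> V" "src G e \<in> wire_verts G"
        using that by blast
    qed
  next
    assume R: ?R
    show ?L
    proof (intro ballI notI)
      fix v w assume vw: "v \<in> ?V" "w \<in> wire_verts G - ?V" and "adjacent (under ?K) v w"
      then obtain e where e: "e \<in> wiring_arcs G"
        and "src G e = v \<and> tgt G e = w \<or> src G e = w \<and> tgt G e = v"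
        unfolding adj by blast
      moreover from e have "src G e \<notin> bang_verts G" "tgt G e \<notin> bang_verts G"
        by (auto simp: wiring)
      ultimately show False
        using R[rule_format, OF e] vw by auto
    qed
  qed
  have fixed_closed: "(\<forall>v \<in> ?V. \<forall>e \<in> incident_arcs (under ?K) v.
        fixed_tedge (etype ?K e) \<longrightarrow> e \<in> tarcs ?S) \<longleftrightarrow>
      (\<forall>e \<in> wiring_arcs G. fixed_tedge (etype G e) \<longrightarrow> (src G e \<in> V \<longleftrightarrow> tgt G e \<in> V))"
    (is "?L \<longleftrightarrow> ?R")
  proof -
    have inc: "e \<in> incident_arcs (under ?K) v \<longleftrightarrow>
        e \<in> wiring_arcs G \<and> (src G e = v \<or> tgt G e = v)" for e v
      unfolding wiring by (auto simp: incident_arcs_def in_arcs_def out_arcs_def)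
    have mem: "e \<in> tarcs ?S \<longleftrightarrow> src G e \<in> V \<and> tgt G e \<in> V"
      "src G e \<in> ?V \<longleftrightarrow> src G e \<in> V" "tgt G e \<in> ?V \<longleftrightarrow> tgt G e \<in> V"
      if "e \<in> wiring_arcs G" for e
      using that[unfolded wiring] by simp_all
    have ty: "etype ?K = etype G"
      by simp
    show ?thesis
      unfolding ty
    proof (rule iffI; intro ballI impI)
      fix e assume "\<forall>v\<in>?V. \<forall>e\<in>incident_arcs (under ?K) v.
          fixed_tedge (etype G e) \<longrightarrow> e \<in> tarcs ?S"
        and e: "e \<in> wiring_arcs G" "fixed_tedge (etype G e)"
      moreover have "e \<in> incident_arcs (under ?K) (src G e)" "e \<in> incident_arcs (under ?K) (tgt G e)"
        using e by (simp_all add: inc)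
      ultimately show "src G e \<in> V \<longleftrightarrow> tgt G e \<in> V"
        using mem[OF e(1)] by blast
    next
      fix v e assume R: "\<forall>e \<in> wiring_arcs G. fixed_tedge (etype G e) \<longrightarrow> (src G e \<in> V \<longleftrightarrow> tgt G e \<in> V)"
        and v: "v \<in> ?V" and e: "e \<in> incident_arcs (under ?K) v" "fixed_tedge (etype G e)"
      then have "e \<in> wiring_arcs G" "src G e = v \<or> tgt G e = v"
        by (simp_all only: inc)
      with R e(2) v mem[of e] show "e \<in> tarcs ?S"
        by blast
    qed
  qed
  have "string_graph T ?S" if op: "wire_open G V"
  proof -
    \<comment> \<open>A fixed-arity arc at a node inside has both ends inside, so the node sees the
      same fixed-arity arcs as in all of U(G).\<close>
    have fixed_in: "{e \<in> fixed_arcs G n. src G e \<in> ?V \<and> tgt G e \<in> ?V}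
        = {e \<in> fixed_arcs G n. src G e \<in> ?W \<and> tgt G e \<in> ?W}" if "n \<in> ?V" for n
    proof -
      have "src G e \<in> ?W" "tgt G e \<in> ?W" "src G e \<in> V \<longleftrightarrow> tgt G e \<in> V" "src G e = n \<or> tgt G e = n"
        if "e \<in> fixed_arcs G n" for e
      proof -
        have e: "e \<in> wiring_arcs G" "fixed_tedge (etype G e)"
          using that fixed_imp_wiring[OF G] by (auto simp: fixed_arcs_def)
        then show "src G e \<in> ?W" "tgt G e \<in> ?W"
          by (simp_all add: wiring)
        show "src G e \<in> V \<longleftrightarrow> tgt G e \<in> V"
          using e op unfolding wire_open_def by blast
        show "src G e = n \<or> tgt G e = n"
          using that by (simp add: fixed_arcs_def)
      qed
      with \<open>n \<in> ?V\<close> show ?thesis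
        by blast
    qed
    have nW: "node_verts G \<inter> ?V \<subseteq> node_verts G \<inter> ?W"
      using V by auto
    show ?thesis
      unfolding string_graph_full_subgraph_iff[OF G WV(2)]
    proof (intro conjI ballI)
      fix n assume n: "n \<in> node_verts G \<inter> ?V"
      then have "bij_betw (etype G) {e \<in> fixed_arcs G n. src G e \<in> ?W \<and> tgt G e \<in> ?W}
          {t \<in> incident_arcs (typegraph T) (vtype G n). fixed_tedge t}"
        using nW str[unfolded U_part_eq string_graph_full_subgraph_iff[OF G WV(1)]] by blast
      then show "bij_betw (etype G) {e \<in> fixed_arcs G n. src G e \<in> ?V \<and> tgt G e \<in> ?V}
          {t \<in> incident_arcs (typegraph T) (vtype G n). fixed_tedge t}"
        unfolding fixed_in[OF IntD2[OF n]] .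
    next
      fix e e' assume e: "e \<in> tarcs G" "e' \<in> tarcs G"
      show "src G e \<in> ?V \<and> tgt G e \<in> ?V \<and> src G e' \<in> ?V \<and> tgt G e' \<in> ?V \<longrightarrow>
        (tgt G e = tgt G e' \<and> tgt G e \<in> wire_verts G \<longrightarrow> e = e') \<and>
        (src G e = src G e' \<and> src G e \<in> wire_verts G \<longrightarrow> e = e')"
      proof (intro impI)
        assume "src G e \<in> ?V \<and> tgt G e \<in> ?V \<and> src G e' \<in> ?V \<and> tgt G e' \<in> ?V"
        then have "src G e \<in> ?W \<and> tgt G e \<in> ?W \<and> src G e' \<in> ?W \<and> tgt G e' \<in> ?W"
          using V by auto
        with str[unfolded U_part_eq string_graph_full_subgraph_iff[OF G WV(1)], THEN conjunct2,
            THEN bspec, OF e(1), THEN bspec, OF e(2)]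
        show "(tgt G e = tgt G e' \<and> tgt G e \<in> wire_verts G \<longrightarrow> e = e') \<and>
          (src G e = src G e' \<and> src G e \<in> wire_verts G \<longrightarrow> e = e')"
          by (rule mp)
      qed
    qed
  qed
  then show ?thesis
    unfolding open_subgraph_def U_part_eq wires full_subgraph_simps(1) adj_closed fixed_closed
    using sub wire_open_def[of G V] by blast
qed

text \<open>The working form of the notion. Transitivity of the order on !-vertices is the nesting
  of boxes restricted to !-vertices, so one nesting clause stands for both.\<close>

lemma bang_graph_iff:
  "bang_graph T G \<longleftrightarrow> typed_graph (bang_typegraph T) G \<and>
     (\<forall>n \<in> node_verts G. bij_betw (etype G) (fixed_arcs G n)
        {t \<in> incident_arcs (typegraph T) (vtype G n). fixed_tedge t}) \<and>
     (\<forall>e \<in> wiring_arcs G. \<forall>e' \<in> wiring_arcs G.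
        (tgt G e = tgt G e' \<and> tgt G e \<in> wire_verts G \<longrightarrow> e = e') \<and>
        (src G e = src G e' \<and> src G e \<in> wire_verts G \<longrightarrow> e = e')) \<and>
     (\<forall>e \<in> tarcs G. \<forall>e' \<in> tarcs G.
        src G e = src G e' \<and> tgt G e = tgt G e' \<and> tgt G e \<in> bang_verts G \<longrightarrow> e = e') \<and>
     (\<forall>b \<in> bang_verts G. b \<in> box G b) \<and>
     (\<forall>b \<in> bang_verts G. \<forall>b' \<in> bang_verts G. b' \<in> box G b \<and> b \<in> box G b' \<longrightarrow> b = b') \<and>
     (\<forall>b \<in> bang_verts G. \<forall>b' \<in> bang_verts G. b' \<in> box G b \<longrightarrow> box G b' \<subseteq> box G b) \<and>
     (\<forall>b \<in> bang_verts G. wire_open G (box G b))"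
proof (cases "typed_graph (bang_typegraph T) G")
  case G: True
  let ?W = "tverts G - bang_verts G"
  note wiring = wiring_arcs_iff[OF G]
  have bang: "bang_part G = full_subgraph G (bang_verts G)"
    by (simp add: bang_part_def)
  have ends: "(b, v) \<in> arcs_ends (under (bang_part G)) \<longleftrightarrow>
      b \<in> bang_verts G \<and> v \<in> bang_verts G \<and> v \<in> box G b" for b v
    unfolding bang by (auto simp: in_box_iff arcs_ends_def arc_to_ends_def)
  have wf: "wf_digraph (under (bang_part G))"
    unfolding bang
    by (rule typed_graphD(5)[OF typed_graph_full_subgraph[OF G]]) (auto simp: bang_verts_def)
  have box: "box G b \<subseteq> tverts G" for b
    using typed_graphD(2)[OF G] by (auto simp: in_box_iff)
  have strU: "string_graph T (U_part G) \<longleftrightarrow>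
     (\<forall>n \<in> node_verts G. bij_betw (etype G) (fixed_arcs G n)
        {t \<in> incident_arcs (typegraph T) (vtype G n). fixed_tedge t}) \<and>
     (\<forall>e \<in> wiring_arcs G. \<forall>e' \<in> wiring_arcs G.
        (tgt G e = tgt G e' \<and> tgt G e \<in> wire_verts G \<longrightarrow> e = e') \<and>
        (src G e = src G e' \<and> src G e \<in> wire_verts G \<longrightarrow> e = e'))"
  proof -
    have "{e \<in> fixed_arcs G n. src G e \<in> ?W \<and> tgt G e \<in> ?W} = fixed_arcs G n" for n
      using fixed_imp_wiring[OF G] by (auto simp: fixed_arcs_def wiring)
    moreover have "node_verts G \<inter> ?W = node_verts G"
      by (auto simp: node_verts_def bang_verts_def)
    moreover have "(\<forall>e \<in> tarcs G. \<forall>e' \<in> tarcs G.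
        src G e \<in> ?W \<and> tgt G e \<in> ?W \<and> src G e' \<in> ?W \<and> tgt G e' \<in> ?W \<longrightarrow> P e e')
        \<longleftrightarrow> (\<forall>e \<in> wiring_arcs G. \<forall>e' \<in> wiring_arcs G. P e e')" for P
      by (auto simp: wiring)
    ultimately show ?thesis
      unfolding U_part_eq string_graph_full_subgraph_iff[OF G order_refl]
      by (simp only:)
  qed
  have nomulti: "nomulti_digraph (under (bang_part G)) \<longleftrightarrow>
     (\<forall>e \<in> tarcs G. \<forall>e' \<in> tarcs G.
        src G e = src G e' \<and> tgt G e = tgt G e' \<and> tgt G e \<in> bang_verts G \<longrightarrow> e = e')"
    using wf tgt_bang_imp_src_bang[OF G]
    unfolding nomulti_digraph_def nomulti_digraph_axioms_def bang
    by (auto simp: arc_to_ends_def)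
  have bv: "tverts (bang_part G) = bang_verts G"
    by (simp add: bang)
  have po: "partial_order_on (tverts (bang_part G)) (arcs_ends (under (bang_part G))) \<longleftrightarrow>
     (\<forall>b \<in> bang_verts G. b \<in> box G b) \<and>
     (\<forall>b \<in> bang_verts G. \<forall>b' \<in> bang_verts G. b' \<in> box G b \<and> b \<in> box G b' \<longrightarrow> b = b') \<and>
     (\<forall>b \<in> bang_verts G. \<forall>b' \<in> bang_verts G. b' \<in> box G b \<longrightarrow>
        box G b' \<inter> bang_verts G \<subseteq> box G b)"
  proof -
    let ?r = "arcs_ends (under (bang_part G))"
    have "refl_on (bang_verts G) ?r \<longleftrightarrow> (\<forall>b \<in> bang_verts G. b \<in> box G b)"
      by (simp add: refl_on_def ends)
    moreover have "?r \<subseteq> bang_verts G \<times> bang_verts G"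
      by (auto simp: ends)
    moreover have "antisym ?r \<longleftrightarrow>
       (\<forall>b \<in> bang_verts G. \<forall>b' \<in> bang_verts G. b' \<in> box G b \<and> b \<in> box G b' \<longrightarrow> b = b')"
      unfolding antisym_def ends by blast
    moreover have "trans ?r \<longleftrightarrow> (\<forall>b \<in> bang_verts G. \<forall>b' \<in> bang_verts G. b' \<in> box G b \<longrightarrow>
        box G b' \<inter> bang_verts G \<subseteq> box G b)"
      unfolding trans_def ends by blast
    ultimately show ?thesis
      unfolding partial_order_on_def preorder_on_def bv by argo
  qed
  have nested: "typed_subgraph (bang_box G b') (bang_box G b) \<longleftrightarrow> box G b' \<subseteq> box G b" for b b'
  proof
    assume "box G b' \<subseteq> box G b"
    moreover have "wf_digraph (under (bang_box G b))"
      using typed_graphD(5)[OF typed_graph_full_subgraph[OF G box]] by (simp add: bang_box_def)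
    ultimately have "typed_subgraph (full_subgraph (bang_box G b) (box G b')) (bang_box G b)"
      by (intro typed_subgraph_full)
    then show "typed_subgraph (bang_box G b') (bang_box G b)"
      using \<open>box G b' \<subseteq> box G b\<close> by (simp add: bang_box_def full_subgraph_full_subgraph)
  qed (rule typed_subgraphD(1))
  have bb: "bang_verts (bang_box G b) = box G b \<inter> bang_verts G" for b
    using box by (auto simp: bang_verts_def bang_box_def)
  show ?thesis
  \<comment> \<open>The translation of openness into \<open>wire_open\<close> presupposes that U(G)
    is a string graph; if it is not, both sides of the equivalence are false.\<close>
  proof (cases "string_graph T (U_part G)")
    case True
    have nested': "(\<forall>b \<in> bang_verts G. \<forall>b' \<in> box G b \<inter> bang_verts G. box G b' \<subseteq> box G b) \<longleftrightarrow>
        (\<forall>b \<in> bang_verts G. \<forall>b' \<in> bang_verts G. b' \<in> box G b \<longrightarrow> box G b' \<subseteq> box G b)"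
      by blast
    have "\<forall>b \<in> bang_verts G. \<forall>b' \<in> bang_verts G. b' \<in> box G b \<longrightarrow>
        box G b' \<inter> bang_verts G \<subseteq> box G b"
      if "\<forall>b \<in> bang_verts G. \<forall>b' \<in> bang_verts G. b' \<in> box G b \<longrightarrow> box G b' \<subseteq> box G b"
      using that by blast
    then show ?thesis
      unfolding bang_graph_def posetal_def nomulti po nested bb U_part_bang_box[OF G]
        open_subgraph_full_iff[OF G box True] strU nested'
      using G by argo
  next
    case False
    then show ?thesis
      unfolding bang_graph_def strU by argo
  qed
qed (simp add: bang_graph_def)

section \<open>Closure of !-graphs under the operations\<close>

lemma bang_graphI:
  assumes "typed_graph (bang_typegraph T) G"
    and "\<And>n. n \<in> node_verts G \<Longrightarrow> bij_betw (etype G) (fixed_arcs G n)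
        {t \<in> incident_arcs (typegraph T) (vtype G n). fixed_tedge t}"
    and "\<And>e e'. \<lbrakk>e \<in> wiring_arcs G; e' \<in> wiring_arcs G; tgt G e = tgt G e'; tgt G e \<in> wire_verts G\<rbrakk>
      \<Longrightarrow> e = e'"
    and "\<And>e e'. \<lbrakk>e \<in> wiring_arcs G; e' \<in> wiring_arcs G; src G e = src G e'; src G e \<in> wire_verts G\<rbrakk>
      \<Longrightarrow> e = e'"
    and "\<And>e e'. \<lbrakk>e \<in> tarcs G; e' \<in> tarcs G; src G e = src G e'; tgt G e = tgt G e';
      tgt G e \<in> bang_verts G\<rbrakk> \<Longrightarrow> e = e'"
    and "\<And>b. b \<in> bang_verts G \<Longrightarrow> b \<in> box G b"
    and "\<And>b b'. \<lbrakk>b \<in> bang_verts G; b' \<in> bang_verts G; b' \<in> box G b; b \<in> box G b'\<rbrakk> \<Longrightarrow> b = b'"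
    and "\<And>b b' v. \<lbrakk>b \<in> bang_verts G; b' \<in> bang_verts G; b' \<in> box G b; v \<in> box G b'\<rbrakk> \<Longrightarrow> v \<in> box G b"
    and "\<And>b. b \<in> bang_verts G \<Longrightarrow> wire_open G (box G b)"
  shows "bang_graph T G"
  unfolding bang_graph_iff
  by (intro conjI ballI impI subsetI; (elim conjE)?; rule assms; assumption)

lemma bang_graphD:
  assumes "bang_graph T G"
  shows "typed_graph (bang_typegraph T) G"
    and "\<And>n. n \<in> node_verts G \<Longrightarrow> bij_betw (etype G) (fixed_arcs G n)
        {t \<in> incident_arcs (typegraph T) (vtype G n). fixed_tedge t}"
    and "\<And>e e'. \<lbrakk>e \<in> wiring_arcs G; e' \<in> wiring_arcs G; tgt G e = tgt G e'; tgt G e \<in> wire_verts G\<rbrakk>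
      \<Longrightarrow> e = e'"
    and "\<And>e e'. \<lbrakk>e \<in> wiring_arcs G; e' \<in> wiring_arcs G; src G e = src G e'; src G e \<in> wire_verts G\<rbrakk>
      \<Longrightarrow> e = e'"
    and "\<And>e e'. \<lbrakk>e \<in> tarcs G; e' \<in> tarcs G; src G e = src G e'; tgt G e = tgt G e';
      tgt G e \<in> bang_verts G\<rbrakk> \<Longrightarrow> e = e'"
    and "\<And>b. b \<in> bang_verts G \<Longrightarrow> b \<in> box G b"
    and "\<And>b b'. \<lbrakk>b \<in> bang_verts G; b' \<in> bang_verts G; b' \<in> box G b; b \<in> box G b'\<rbrakk> \<Longrightarrow> b = b'"
    and "\<And>b b' v. \<lbrakk>b \<in> bang_verts G; b' \<in> bang_verts G; b' \<in> box G b; v \<in> box G b'\<rbrakk> \<Longrightarrow> v \<in> box G b"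
    and "\<And>b. b \<in> bang_verts G \<Longrightarrow> wire_open G (box G b)"
  by (use assms[unfolded bang_graph_iff] in \<open>elim conjE, blast\<close>)+

lemma wire_openD:
  assumes "wire_open G V" "e \<in> wiring_arcs G"
  shows "\<lbrakk>src G e \<in> V; tgt G e \<in> wire_verts G\<rbrakk> \<Longrightarrow> tgt G e \<in> V"
    and "\<lbrakk>tgt G e \<in> V; src G e \<in> wire_verts G\<rbrakk> \<Longrightarrow> src G e \<in> V"
    and "fixed_tedge (etype G e) \<Longrightarrow> src G e \<in> V \<longleftrightarrow> tgt G e \<in> V"
  using assms unfolding wire_open_def by blast+

section \<open>Removing an open set of vertices\<close>

lemma remove_verts_simps:
  assumes "typed_graph TG G"
  shows "tverts (remove_verts G D) = tverts G - D"
    and "tarcs (remove_verts G D) = {e \<in> tarcs G. src G e \<notin> D \<and> tgt G e \<notin> D}"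
    and "src (remove_verts G D) = src G"
    and "tgt (remove_verts G D) = tgt G"
    and "typing (remove_verts G D) = typing G"
    and "bang_verts (remove_verts G D) = bang_verts G - D"
    and "wire_verts (remove_verts G D) = wire_verts G - D"
    and "node_verts (remove_verts G D) = node_verts G - D"
    and "wiring_arcs (remove_verts G D) = {e \<in> wiring_arcs G. src G e \<notin> D \<and> tgt G e \<notin> D}"
    and "v \<in> box (remove_verts G D) b \<longleftrightarrow> v \<in> box G b \<and> v \<notin> D \<and> b \<notin> D"
  using typed_graphD(1,2)[OF assms]
  by (auto simp: remove_verts_def bang_verts_def wire_verts_def node_verts_def wiring_arcs_def
      in_box_iff)

text \<open>Openness puts both ends of a fixed-arity arc on the same side of \<open>D\<close>, so
  surviving nodes keep all of them. The other conditions pass to the remaining vertices and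
  arcs.\<close>

lemma bang_graph_remove_verts:
  assumes G: "bang_graph T G" and op: "wire_open G D"
  shows "bang_graph T (remove_verts G D)"
proof -
  note Gt = bang_graphD(1)[OF G]
  note [simp] = remove_verts_simps[OF Gt]
  have fixed: "fixed_arcs (remove_verts G D) n = fixed_arcs G n" if "n \<notin> D" for n
    using that wire_openD(3)[OF op] fixed_imp_wiring[OF Gt]
    by (auto simp: fixed_arcs_def)
  show ?thesis
  proof (rule bang_graphI)
    show "typed_graph (bang_typegraph T) (remove_verts G D)"
      unfolding remove_verts_def by (rule typed_graph_full_subgraph[OF Gt]) auto
  next
    fix n assume "n \<in> node_verts (remove_verts G D)"
    then show "bij_betw (etype (remove_verts G D)) (fixed_arcs (remove_verts G D) n)
        {t \<in> incident_arcs (typegraph T) (vtype (remove_verts G D) n). fixed_tedge t}"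
      using bang_graphD(2)[OF G, of n] by (simp add: fixed)
  next
    fix b assume b: "b \<in> bang_verts (remove_verts G D)"
    show "wire_open (remove_verts G D) (box (remove_verts G D) b)"
      unfolding wire_open_def
    proof (rule ballI)
      fix e assume "e \<in> wiring_arcs (remove_verts G D)"
      then have e: "e \<in> wiring_arcs G" "src G e \<notin> D" "tgt G e \<notin> D"
        by simp_all
      have "b \<in> bang_verts G" "b \<notin> D"
        using b by simp_all
      with e wire_openD[OF bang_graphD(9)[OF G \<open>b \<in> bang_verts G\<close>] e(1)]
      show "(src (remove_verts G D) e \<in> box (remove_verts G D) b \<and>
          tgt (remove_verts G D) e \<in> wire_verts (remove_verts G D)
          \<longrightarrow> tgt (remove_verts G D) e \<in> box (remove_verts G D) b) \<and>
        (tgt (remove_verts G D) e \<in> box (remove_verts G D) b \<and>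
          src (remove_verts G D) e \<in> wire_verts (remove_verts G D)
          \<longrightarrow> src (remove_verts G D) e \<in> box (remove_verts G D) b) \<and>
        (fixed_tedge (etype (remove_verts G D) e) \<longrightarrow>
          (src (remove_verts G D) e \<in> box (remove_verts G D) b \<longleftrightarrow>
           tgt (remove_verts G D) e \<in> box (remove_verts G D) b))"
        unfolding remove_verts_simps[OF Gt] Diff_iff by blast
    qed
  next
    fix b b' v
    assume "b \<in> bang_verts (remove_verts G D)" "b' \<in> bang_verts (remove_verts G D)"
      "b' \<in> box (remove_verts G D) b" "v \<in> box (remove_verts G D) b'"
    then show "v \<in> box (remove_verts G D) b"
      using bang_graphD(8)[OF G, of b b' v] by simp
  qed (simp_all add: bang_graphD(3-7)[OF G])
qed

text \<open>Wiring arcs never end or start at a !-vertex, so the conditions are trivially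
  met.\<close>

lemma wire_open_bang:
  assumes "bang_graph T G" "b \<in> bang_verts G"
  shows "wire_open G {b}"
  using assms(2) wiring_arcs_iff[OF bang_graphD(1)[OF assms(1)]] by (auto simp: wire_open_def)

section \<open>Copying a box\<close>

text \<open>The part shared by the two copies contains exactly the arcs with neither end in the box,
  so an arc is doubled as soon as one end lies there. An end outside the box gets the tag
  \<open>False\<close>: both copies of a crossing arc attach to the same shared vertex.\<close>

lemma COPY_simps:
  assumes "typed_graph TG G"
  shows "(v, k) \<in> tverts (COPY b G) \<longleftrightarrow> v \<in> tverts G \<and> (k \<longrightarrow> v \<in> box G b)"
    and "(e, k) \<in> tarcs (COPY b G) \<longleftrightarrow>
      e \<in> tarcs G \<and> (k \<longrightarrow> src G e \<in> box G b \<or> tgt G e \<in> box G b)"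
    and "e \<in> tarcs G \<Longrightarrow> src (COPY b G) (e, k) = (src G e, k \<and> src G e \<in> box G b)"
    and "e \<in> tarcs G \<Longrightarrow> tgt (COPY b G) (e, k) = (tgt G e, k \<and> tgt G e \<in> box G b)"
    and "vtype (COPY b G) (v, k) = vtype G v"
    and "etype (COPY b G) (e, k) = etype G e"
  using typed_graphD(1,2)[OF assms]
  by (auto simp: COPY_def self_pushout_simps remove_verts_def image_iff)

lemma COPY_vertex_simps:
  assumes "typed_graph TG G"
  shows "(v, k) \<in> bang_verts (COPY b G) \<longleftrightarrow> v \<in> bang_verts G \<and> (k \<longrightarrow> v \<in> box G b)"
    and "(v, k) \<in> wire_verts (COPY b G) \<longleftrightarrow> v \<in> wire_verts G \<and> (k \<longrightarrow> v \<in> box G b)"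
    and "(v, k) \<in> node_verts (COPY b G) \<longleftrightarrow> v \<in> node_verts G \<and> (k \<longrightarrow> v \<in> box G b)"
    and "(e, k) \<in> wiring_arcs (COPY b G) \<longleftrightarrow>
      e \<in> wiring_arcs G \<and> (k \<longrightarrow> src G e \<in> box G b \<or> tgt G e \<in> box G b)"
  using typed_graphD(1,2)[OF assms] COPY_simps(3)[OF assms]
  by (auto simp: bang_verts_def wire_verts_def node_verts_def wiring_arcs_def COPY_simps[OF assms])

text \<open>By nesting, the box of a !-vertex inside the copied box is copied along with it, so
  owner and content have equal tags. A !-vertex outside is shared, and its box receives every copy
  of what it contained.\<close>

lemma in_box_COPY_iff:
  assumes G: "bang_graph T G" and b: "b \<in> bang_verts G"
    and x: "(x, k) \<in> bang_verts (COPY b G)"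
  shows "(y, l) \<in> box (COPY b G) (x, k) \<longleftrightarrow>
    y \<in> box G x \<and> (l \<longrightarrow> y \<in> box G b) \<and> (x \<in> box G b \<longrightarrow> l = k)"
proof -
  note Gt = bang_graphD(1)[OF G]
  have x': "x \<in> bang_verts G" "k \<longrightarrow> x \<in> box G b"
    using x by (simp_all add: COPY_vertex_simps[OF Gt])
  have nested: "y \<in> box G b" if "x \<in> box G b" "y \<in> box G x"
    using bang_graphD(8)[OF G b x'(1) that] .
  show ?thesis
  proof
    assume "(y, l) \<in> box (COPY b G) (x, k)"
    then obtain e j where e: "(e, j) \<in> tarcs (COPY b G)"
      "src (COPY b G) (e, j) = (x, k)" "tgt (COPY b G) (e, j) = (y, l)"
      by (auto simp: in_box_iff)
    then have e': "e \<in> tarcs G"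
      by (simp add: COPY_simps[OF Gt])
    have "y \<in> box G x"
      using e e' by (auto simp: COPY_simps[OF Gt] in_box_iff[of y G x])
    with e e' nested show "y \<in> box G x \<and> (l \<longrightarrow> y \<in> box G b) \<and> (x \<in> box G b \<longrightarrow> l = k)"
      by (auto simp: COPY_simps[OF Gt])
  next
    assume y: "y \<in> box G x \<and> (l \<longrightarrow> y \<in> box G b) \<and> (x \<in> box G b \<longrightarrow> l = k)"
    then obtain e where e: "e \<in> tarcs G" "src G e = x" "tgt G e = y"
      by (auto simp: in_box_iff[of y G x])
    \<comment> \<open>The lift takes the tag \<open>l\<close> of the target. Its source then has tag
      \<open>k\<close>: if \<open>x\<close> is in the box, \<open>l = k\<close>; otherwise both the
      source tag and \<open>k\<close> are \<open>False\<close>.\<close>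
    then have "(e, l) \<in> tarcs (COPY b G)" "src (COPY b G) (e, l) = (x, k)"
      "tgt (COPY b G) (e, l) = (y, l)"
      using y x' by (auto simp: COPY_simps[OF Gt])
    then show "(y, l) \<in> box (COPY b G) (x, k)"
      unfolding in_box_iff by blast
  qed
qed

text \<open>Arcs of the copy that violate uniqueness project to arcs of \<open>G\<close> that must
  coincide. It remains to compare tags, which is where openness and nesting enter.\<close>

lemma bang_graph_COPY:
  assumes G: "bang_graph T G" and b: "b \<in> bang_verts G"
  shows "bang_graph T (COPY b G)"
proof -
  let ?K = "COPY b G" and ?B = "box G b"
  note Gt = bang_graphD(1)[OF G]
  note wiring = wiring_arcs_iff[OF Gt]
  note op = wire_openD[OF bang_graphD(9)[OF G b]]
  note cs = COPY_simps[OF Gt] COPY_vertex_simps[OF Gt]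
  note box = in_box_COPY_iff[OF G b]
  have wa: "e \<in> tarcs G" if "e \<in> wiring_arcs G" for e
    using that by (simp add: wiring)
  show ?thesis
  proof (rule bang_graphI)
    show "typed_graph (bang_typegraph T) ?K"
      unfolding COPY_def remove_verts_def
      by (intro typed_graph_self_pushout[OF Gt] typed_subgraph_full typed_graphD(5)[OF Gt]) auto
  next
    fix n assume n: "n \<in> node_verts ?K"
    obtain m k where nk: "n = (m, k)" by (cases n)
    have m: "m \<in> node_verts G" "k \<longrightarrow> m \<in> ?B"
      using n by (simp_all add: nk cs)
    \<comment> \<open>A fixed-arity arc has both ends in the box or neither, so its tag is that of
      its ends.\<close>
    have "fixed_arcs ?K n = (\<lambda>e. (e, k)) ` fixed_arcs G m"
    proof (intro set_eqI iffI)
      fix a assume a: "a \<in> fixed_arcs ?K n"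
      obtain e j where ej: "a = (e, j)" by (cases a)
      have e: "e \<in> tarcs G" "fixed_tedge (etype G e)" "j \<longrightarrow> src G e \<in> ?B \<or> tgt G e \<in> ?B"
        using a by (auto simp: fixed_arcs_def ej cs)
      then have "src G e \<in> ?B \<longleftrightarrow> tgt G e \<in> ?B"
        using op(3) fixed_imp_wiring[OF Gt] by blast
      with a e m(2) show "a \<in> (\<lambda>e. (e, k)) ` fixed_arcs G m"
        by (auto simp: fixed_arcs_def ej cs nk)
    next
      fix a assume "a \<in> (\<lambda>e. (e, k)) ` fixed_arcs G m"
      then obtain e where e: "a = (e, k)" "e \<in> tarcs G" "fixed_tedge (etype G e)"
        "src G e = m \<or> tgt G e = m"
        by (auto simp: fixed_arcs_def)
      with m(2) show "a \<in> fixed_arcs ?K n"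
        by (auto simp: fixed_arcs_def cs nk)
    qed
    moreover have "bij_betw (\<lambda>e. (e, k)) (fixed_arcs G m) ((\<lambda>e. (e, k)) ` fixed_arcs G m)"
      by (auto simp: bij_betw_def inj_on_def)
    moreover have "etype ?K \<circ> (\<lambda>e. (e, k)) = etype G"
      by (auto simp: cs)
    ultimately show "bij_betw (etype ?K) (fixed_arcs ?K n)
        {t \<in> incident_arcs (typegraph T) (vtype ?K n). fixed_tedge t}"
      using bang_graphD(2)[OF G m(1)] by (simp add: bij_betw_comp_iff nk cs)
  next
    fix a a' assume a: "a \<in> wiring_arcs ?K" "a' \<in> wiring_arcs ?K" "tgt ?K a = tgt ?K a'"
      "tgt ?K a \<in> wire_verts ?K"
    obtain e j e' j' where ej: "a = (e, j)" "a' = (e', j')" by (cases a; cases a')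
    have e: "e \<in> wiring_arcs G" "e' \<in> wiring_arcs G"
      using a by (simp_all add: ej cs)
    have w: "tgt G e = tgt G e'" "tgt G e \<in> wire_verts G"
      using a wa[OF e(1)] wa[OF e(2)] by (simp_all add: ej cs)
    \<comment> \<open>Different tags on the same arc would require a doubled arc with a shared
      target, that is, a source in the box and a wire-vertex outside as target, against
      openness.\<close>
    have "e = e'"
      by (rule bang_graphD(3)[OF G e w])
    then show "a = a'"
      using a wa[OF e(1)] op(1)[OF e(1)] w by (auto simp: ej cs)
  next
    fix a a' assume a: "a \<in> wiring_arcs ?K" "a' \<in> wiring_arcs ?K" "src ?K a = src ?K a'"
      "src ?K a \<in> wire_verts ?K"
    obtain e j e' j' where ej: "a = (e, j)" "a' = (e', j')" by (cases a; cases a')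
    have e: "e \<in> wiring_arcs G" "e' \<in> wiring_arcs G"
      using a by (simp_all add: ej cs)
    have w: "src G e = src G e'" "src G e \<in> wire_verts G"
      using a wa[OF e(1)] wa[OF e(2)] by (simp_all add: ej cs)
    have "e = e'"
      by (rule bang_graphD(4)[OF G e w])
    then show "a = a'"
      using a wa[OF e(1)] op(2)[OF e(1)] w by (auto simp: ej cs)
  next
    fix a a' assume a: "a \<in> tarcs ?K" "a' \<in> tarcs ?K" "src ?K a = src ?K a'"
      "tgt ?K a = tgt ?K a'" "tgt ?K a \<in> bang_verts ?K"
    obtain e j e' j' where ej: "a = (e, j)" "a' = (e', j')" by (cases a; cases a')
    have e: "e \<in> tarcs G" "e' \<in> tarcs G"
      using a by (simp_all add: ej cs)
    have w: "src G e = src G e'" "tgt G e = tgt G e'" "tgt G e \<in> bang_verts G"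
      using a e by (simp_all add: ej cs)
    have "e = e'"
      by (rule bang_graphD(5)[OF G e w])
    \<comment> \<open>By nesting, a doubled arc into a !-vertex has its target in the box, and the
      tag of the arc can be read off there.\<close>
    moreover have "tgt G e \<in> ?B" if "src G e \<in> ?B"
      using that bang_graphD(8)[OF G b tgt_bang_imp_src_bang[OF Gt e(1) w(3)] that] e(1)
      by (auto simp: in_box_iff)
    ultimately show "a = a'"
      using a e by (auto simp: ej cs)
  next
    fix x assume x: "x \<in> bang_verts ?K"
    obtain c k where ck: "x = (c, k)" by (cases x)
    show "x \<in> box ?K x"
      using x bang_graphD(6)[OF G, of c] unfolding ck box[OF x[unfolded ck]]
      by (auto simp: cs)
  next
    fix x x' assume x: "x \<in> bang_verts ?K" "x' \<in> bang_verts ?K" and xx: "x' \<in> box ?K x" "x \<in> box ?K x'"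
    obtain c k c' k' where ck: "x = (c, k)" "x' = (c', k')" by (cases x; cases x')
    show "x = x'"
      using x xx bang_graphD(7)[OF G, of c c']
      unfolding ck box[OF x(1)[unfolded ck]] box[OF x(2)[unfolded ck]]
      by (auto simp: cs)
  next
    fix x x' v assume x: "x \<in> bang_verts ?K" "x' \<in> bang_verts ?K" and xx: "x' \<in> box ?K x" "v \<in> box ?K x'"
    obtain c k c' k' y l where ck: "x = (c, k)" "x' = (c', k')" "v = (y, l)"
      by (cases x; cases x'; cases v)
    show "v \<in> box ?K x"
      using x xx bang_graphD(8)[OF G, of c c' y] bang_graphD(8)[OF G b, of c c']
      unfolding ck box[OF x(1)[unfolded ck]] box[OF x(2)[unfolded ck]]
      by (auto simp: cs)
  next
    fix x assume x: "x \<in> bang_verts ?K"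
    obtain c k where ck: "x = (c, k)" by (cases x)
    have c: "c \<in> bang_verts G" "k \<longrightarrow> c \<in> ?B"
      using x by (simp_all add: ck cs)
    note opc = wire_openD[OF bang_graphD(9)[OF G c(1)]]
    \<comment> \<open>If \<open>c\<close> lies in the copied box, membership in the box of
      \<open>(c, k)\<close> also compares tags. Everything in the box of \<open>c\<close> is then
      doubled, and a doubled end carries the tag of its arc.\<close>
    have nested: "v \<in> ?B" if "c \<in> ?B" "v \<in> box G c" for v
      using bang_graphD(8)[OF G b c(1) that] .
    show "wire_open ?K (box ?K x)"
      unfolding wire_open_def
    proof (intro ballI)
      fix a assume a: "a \<in> wiring_arcs ?K"
      obtain e j where ej: "a = (e, j)" by (cases a)
      have e: "e \<in> wiring_arcs G" "e \<in> tarcs G"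
        using a wa by (auto simp: ej cs)
      have K: "src ?K a = (src G e, j \<and> src G e \<in> ?B)" "tgt ?K a = (tgt G e, j \<and> tgt G e \<in> ?B)"
        using e by (simp_all add: ej cs)
      show "(src ?K a \<in> box ?K x \<and> tgt ?K a \<in> wire_verts ?K \<longrightarrow> tgt ?K a \<in> box ?K x) \<and>
        (tgt ?K a \<in> box ?K x \<and> src ?K a \<in> wire_verts ?K \<longrightarrow> src ?K a \<in> box ?K x) \<and>
        (fixed_tedge (etype ?K a) \<longrightarrow> (src ?K a \<in> box ?K x \<longleftrightarrow> tgt ?K a \<in> box ?K x))"
        unfolding K unfolding ej ck box[OF x[unfolded ck]] COPY_simps(6)[OF Gt] COPY_vertex_simps[OF Gt]
        using opc[OF e(1)] nested[of "src G e"] nested[of "tgt G e"]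
        by blast
    qed
  qed
qed

section \<open>Elementwise description of !-graph equations\<close>

lemma inputs_U_part_iff:
  assumes "typed_graph (bang_typegraph T) G"
  shows "w \<in> inputs (U_part G) \<longleftrightarrow> w \<in> wire_verts G \<and> (\<forall>e \<in> wiring_arcs G. tgt G e \<noteq> w)"
  by (auto simp: inputs_def U_part_eq wire_verts_def bang_verts_def in_arcs_def
      wiring_arcs_iff[OF assms])

lemma outputs_U_part_iff:
  assumes "typed_graph (bang_typegraph T) G"
  shows "w \<in> outputs (U_part G) \<longleftrightarrow> w \<in> wire_verts G \<and> (\<forall>e \<in> wiring_arcs G. src G e \<noteq> w)"
  by (auto simp: outputs_def U_part_eq wire_verts_def bang_verts_def out_arcs_def
      wiring_arcs_iff[OF assms])

lemma no_isolated_wires_iff: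
  assumes "typed_graph (bang_typegraph T) G"
  shows "isolated_wires (U_part G) = {} \<longleftrightarrow>
    (\<forall>w \<in> wire_verts G. \<exists>e \<in> wiring_arcs G. src G e = w \<or> tgt G e = w)"
proof -
  have "wire_verts (U_part G) = wire_verts G"
    by (auto simp: U_part_eq wire_verts_def bang_verts_def)
  moreover have "incident_arcs (under (U_part G)) w = {e \<in> wiring_arcs G. src G e = w \<or> tgt G e = w}" for w
    unfolding U_part_eq wiring_arcs_iff[OF assms] by (auto simp: incident_arcs_def in_arcs_def out_arcs_def)
  ultimately show ?thesis
    by (auto simp: isolated_wires_def)
qed

lemma Bound_bang_simps [simp]:
  "tverts (Bound_bang G) = bang_verts G \<union> inputs (U_part G) \<union> outputs (U_part G)"
  "tarcs (Bound_bang G) =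
     {e \<in> tarcs G. src G e \<in> bang_verts G \<and> tgt G e \<in> tverts (Bound_bang G)}"
  "src (Bound_bang G) = src G" "tgt (Bound_bang G) = tgt G" "typing (Bound_bang G) = typing G"
  by (simp_all add: Bound_bang_def Let_def)

section \<open>Legs as bijections onto the boundary\<close>

text \<open>This replaces the existentially quantified isomorphism between the boundary and
  \<open>I\<close>: the commutation conditions determine it from the leg.\<close>

definition boundary_embedding ::
  "('v, 'e, 'o, 'm) tgraph \<Rightarrow> ('w, 'f, 'o, 'm) tgraph \<Rightarrow> ('v, 'e, 'w, 'f) gmap \<Rightarrow> bool" where
  "boundary_embedding I G i \<longleftrightarrow> is_mor I G i \<and>
     bij_betw (vmap i) (tverts I) (tverts (Bound_bang G)) \<and>
     bij_betw (emap i) (tarcs I) (tarcs (Bound_bang G))"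

lemma is_morD:
  assumes "is_mor G H f"
  shows "v \<in> tverts G \<Longrightarrow> vmap f v \<in> tverts H"
    and "e \<in> tarcs G \<Longrightarrow> emap f e \<in> tarcs H"
    and "e \<in> tarcs G \<Longrightarrow> src H (emap f e) = vmap f (src G e)"
    and "e \<in> tarcs G \<Longrightarrow> tgt H (emap f e) = vmap f (tgt G e)"
    and "v \<in> tverts G \<Longrightarrow> vtype H (vmap f v) = vtype G v"
    and "e \<in> tarcs G \<Longrightarrow> etype H (emap f e) = etype G e"
  using assms by (auto simp: is_mor_def graph_hom_def mor_eq_def gcomp_def)

lemma is_morI:
  assumes "\<And>v. v \<in> tverts G \<Longrightarrow> vmap f v \<in> tverts H"
    and "\<And>e. e \<in> tarcs G \<Longrightarrow> emap f e \<in> tarcs H"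
    and "\<And>e. e \<in> tarcs G \<Longrightarrow> src H (emap f e) = vmap f (src G e)"
    and "\<And>e. e \<in> tarcs G \<Longrightarrow> tgt H (emap f e) = vmap f (tgt G e)"
    and "\<And>v. v \<in> tverts G \<Longrightarrow> vtype H (vmap f v) = vtype G v"
    and "\<And>e. e \<in> tarcs G \<Longrightarrow> etype H (emap f e) = etype G e"
  shows "is_mor G H f"
  using assms by (auto simp: is_mor_def graph_hom_def mor_eq_def gcomp_def)

text \<open>Outside the image, \<open>inv_into\<close> returns arbitrary values, which
  \<open>is_mor\<close> and \<open>mor_eq\<close> never inspect.\<close>

definition ginv :: "('v, 'e, 'o, 'm) tgraph \<Rightarrow> ('v, 'e, 'w, 'f) gmap \<Rightarrow> ('w, 'f, 'v, 'e) gmap" where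
  "ginv G f = \<lparr> vmap = inv_into (tverts G) (vmap f), emap = inv_into (tarcs G) (emap f) \<rparr>"

lemma ginv_simps:
  assumes "bij_betw (vmap f) (tverts G) V" "bij_betw (emap f) (tarcs G) E"
  shows "v \<in> tverts G \<Longrightarrow> vmap (ginv G f) (vmap f v) = v"
    and "e \<in> tarcs G \<Longrightarrow> emap (ginv G f) (emap f e) = e"
    and "w \<in> V \<Longrightarrow> vmap f (vmap (ginv G f) w) = w"
    and "a \<in> E \<Longrightarrow> emap f (emap (ginv G f) a) = a"
    and "w \<in> V \<Longrightarrow> vmap (ginv G f) w \<in> tverts G"
    and "a \<in> E \<Longrightarrow> emap (ginv G f) a \<in> tarcs G"
  using assms
  by (auto simp: ginv_def bij_betw_def inv_into_into intro: f_inv_into_f)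

lemma is_iso_ginv:
  assumes wf: "wf_digraph (under G)" and f: "is_mor G H f"
    and bij: "bij_betw (vmap f) (tverts G) (tverts H)" "bij_betw (emap f) (tarcs G) (tarcs H)"
  shows "is_iso G H f" "is_iso H G (ginv G f)"
proof -
  let ?g = "ginv G f"
  note g = ginv_simps[OF bij]
  have ends: "src G a \<in> tverts G" "tgt G a \<in> tverts G" if "a \<in> tarcs G" for a
    using wf that by (auto simp: wf_digraph_def)
  have "is_mor H G ?g"
  proof (rule is_morI)
    fix a assume a: "a \<in> tarcs H"
    note ga = g(6)[OF a]
    show "src G (emap ?g a) = vmap ?g (src H a)"
      using is_morD(3)[OF f ga] g(1)[OF ends(1)[OF ga]] g(4)[OF a] by simp
    show "tgt G (emap ?g a) = vmap ?g (tgt H a)"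
      using is_morD(4)[OF f ga] g(1)[OF ends(2)[OF ga]] g(4)[OF a] by simp
    show "etype G (emap ?g a) = etype H a"
      using is_morD(6)[OF f ga] g(4)[OF a] by simp
  next
    fix w assume w: "w \<in> tverts H"
    show "vtype G (vmap ?g w) = vtype H w"
      using is_morD(5)[OF f g(5)[OF w]] g(3)[OF w] by simp
  qed (fact g)+
  moreover have "mor_eq G (?g \<circ>\<^sub>g f) incl" "mor_eq H (f \<circ>\<^sub>g ?g) incl"
    using g by (auto simp: mor_eq_def gcomp_def incl_def)
  ultimately show "is_iso G H f" "is_iso H G ?g"
    using f by (auto simp: is_iso_def)
qed

text \<open>\<open>Bound_bang G\<close> contains every arc from a !-vertex to a boundary vertex, so
  surjectivity on its arcs is what gives reflection of !-box containment.\<close>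

lemma boundary_embeddingD:
  assumes "boundary_embedding I G i"
  shows "is_mor I G i" "bij_betw (vmap i) (tverts I) (tverts (Bound_bang G))"
    "bij_betw (emap i) (tarcs I) (tarcs (Bound_bang G))"
    "is_mor I (Bound_bang G) i" "monic I i" "reflects_bang_boxes I G i"
proof -
  show i: "is_mor I G i" and v: "bij_betw (vmap i) (tverts I) (tverts (Bound_bang G))"
    and e: "bij_betw (emap i) (tarcs I) (tarcs (Bound_bang G))"
    using assms by (simp_all only: boundary_embedding_def)
  show "is_mor I (Bound_bang G) i"
  proof (rule is_morI)
    show "\<And>x. x \<in> tverts I \<Longrightarrow> vmap i x \<in> tverts (Bound_bang G)"
      "\<And>x. x \<in> tarcs I \<Longrightarrow> emap i x \<in> tarcs (Bound_bang G)"
      using v e by (auto dest: bij_betwE simp del: Bound_bang_simps(1,2))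
  qed (use is_morD(3-6)[OF i] in simp_all)
  show "monic I i"
    using v e by (simp add: monic_def bij_betw_def)
  show "reflects_bang_boxes I G i"
    unfolding reflects_bang_boxes_def
  proof (intro ballI impI)
    fix a assume "a \<in> tarcs G" "src G a \<in> bang_verts G \<and> tgt G a \<in> vmap i ` tverts I"
    then have "a \<in> tarcs (Bound_bang G)"
      using v by (simp add: bij_betw_def)
    then show "a \<in> emap i ` tarcs I"
      using e by (simp add: bij_betw_def)
  qed
qed

text \<open>On the boundary \<open>i\<close> undoes \<open>\<phi>\<close>, and \<open>\<phi>\<close>
  has an inverse \<open>g\<close>; together these force \<open>i\<close> to agree with
  \<open>g\<close> on \<open>I\<close>.\<close>

lemma boundary_embedding_of_iso:
  assumes i: "is_mor I G i" and phi: "is_iso (Bound_bang G) I \<phi>"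
    and inp: "mor_eq (In_bang G) (i \<circ>\<^sub>g (\<phi> \<circ>\<^sub>g incl)) incl"
    and outp: "mor_eq (Out_bang G) (i \<circ>\<^sub>g (\<phi> \<circ>\<^sub>g incl)) incl"
  shows "boundary_embedding I G i"
    and "\<And>y. y \<in> tverts (Bound_bang G) \<Longrightarrow> vmap i (vmap \<phi> y) = y"
    and "\<And>x. x \<in> tverts I \<Longrightarrow> vmap \<phi> (vmap i x) = x"
proof -
  from phi obtain g where \<phi>: "is_mor (Bound_bang G) I \<phi>" and g: "is_mor I (Bound_bang G) g"
    and \<phi>g: "mor_eq I (\<phi> \<circ>\<^sub>g g) incl"
    by (auto simp: is_iso_def)
  \<comment> \<open>\<open>In_bang G\<close> and \<open>Out_bang G\<close> together cover the
    boundary. This also holds for its arcs, which start at a !-vertex and end at a !-vertex, an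
    input or an output.\<close>
  show v: "vmap i (vmap \<phi> y) = y" if "y \<in> tverts (Bound_bang G)" for y
    using that inp outp
    by (auto simp: In_bang_def Out_bang_def mor_eq_def gcomp_def incl_def)
  have e: "emap i (emap \<phi> y) = y" if "y \<in> tarcs (Bound_bang G)" for y
    using that inp outp
    by (auto simp: In_bang_def Out_bang_def mor_eq_def gcomp_def incl_def)
  have gv: "vmap \<phi> (vmap g x) = x" if "x \<in> tverts I" for x
    using \<phi>g that by (auto simp: mor_eq_def gcomp_def incl_def)
  have ge: "emap \<phi> (emap g x) = x" if "x \<in> tarcs I" for x
    using \<phi>g that by (auto simp: mor_eq_def gcomp_def incl_def)
  have iv: "vmap i x = vmap g x" if "x \<in> tverts I" for x
    using v[OF is_morD(1)[OF g that]] gv[OF that] by simp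
  have ie: "emap i x = emap g x" if "x \<in> tarcs I" for x
    using e[OF is_morD(2)[OF g that]] ge[OF that] by simp
  show iphi: "vmap \<phi> (vmap i x) = x" if "x \<in> tverts I" for x
    using iv[OF that] gv[OF that] by simp
  have "bij_betw (vmap i) (tverts I) (tverts (Bound_bang G))"
  proof (rule bij_betw_byWitness[where f' = "vmap \<phi>"])
    show "vmap i ` tverts I \<subseteq> tverts (Bound_bang G)"
      using is_morD(1)[OF g] iv by (metis image_subsetI)
    show "vmap \<phi> ` tverts (Bound_bang G) \<subseteq> tverts I"
      using is_morD(1)[OF \<phi>] by blast
  qed (use v iphi in blast)+
  moreover have "bij_betw (emap i) (tarcs I) (tarcs (Bound_bang G))"
  proof (rule bij_betw_byWitness[where f' = "emap \<phi>"])
    show "emap i ` tarcs I \<subseteq> tarcs (Bound_bang G)"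
      using is_morD(2)[OF g] ie by (metis image_subsetI)
    show "emap \<phi> ` tarcs (Bound_bang G) \<subseteq> tarcs I"
      using is_morD(2)[OF \<phi>] by blast
    show "\<forall>x\<in>tarcs I. emap \<phi> (emap i x) = x"
      using ie ge by simp
  qed (use e in blast)
  ultimately show "boundary_embedding I G i"
    using i by (simp only: boundary_embedding_def)
qed

lemma bij_betw_filter:
  assumes "bij_betw f A B" "\<And>x. x \<in> A \<Longrightarrow> P x \<longleftrightarrow> Q (f x)"
  shows "bij_betw f {x \<in> A. P x} {y \<in> B. Q y}"
  using assms by (auto simp: bij_betw_def inj_on_def)

text \<open>\<open>Bound_bang G\<close> is not full: it omits an arc leading straight from an input
  to an output. The full subgraphs on inputs or on outputs alone have no such arcs, since nothing in
  U(G) enters an input or leaves an output.\<close>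

lemma full_boundary_arcs:
  assumes G: "typed_graph (bang_typegraph T) G"
  shows "tarcs (In_bang G) = {e \<in> tarcs (Bound_bang G). tgt G e \<in> tverts (In_bang G)}"
    and "tarcs (Out_bang G) = {e \<in> tarcs (Bound_bang G). tgt G e \<in> tverts (Out_bang G)}"
proof -
  have "src G e \<in> bang_verts G"
    if e: "e \<in> tarcs G" "tgt G e \<in> bang_verts G \<union> inputs (U_part G)" for e
    using e tgt_bang_imp_src_bang[OF G]
    by (auto simp: inputs_U_part_iff[OF G] wiring_arcs_def)
  then show "tarcs (In_bang G) = {e \<in> tarcs (Bound_bang G). tgt G e \<in> tverts (In_bang G)}"
    by (auto simp: In_bang_def)
  have "src G e \<in> bang_verts G"
    if e: "e \<in> tarcs G" "src G e \<in> bang_verts G \<union> outputs (U_part G)" for e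
    using e by (auto simp: outputs_U_part_iff[OF G] wiring_arcs_def)
  then show "tarcs (Out_bang G) = {e \<in> tarcs (Bound_bang G). tgt G e \<in> tverts (Out_bang G)}"
    by (auto simp: Out_bang_def)
qed

text \<open>The arc hypotheses on \<open>A\<close> and \<open>A'\<close> make membership of a
  boundary arc depend on its target alone, so the comparison of whole boundaries restricts by
  filtering. General sets let inputs and outputs share the argument.\<close>

lemma is_iso_between_boundaries:
  assumes I: "wf_digraph (under I)" and L: "wf_digraph (under L)"
    and i1: "boundary_embedding I L i1" and i2: "boundary_embedding I R i2"
    and AL: "A \<subseteq> tverts (Bound_bang L)"
      "tarcs (full_subgraph L A) = {e \<in> tarcs (Bound_bang L). tgt L e \<in> A}"
    and AR: "A' \<subseteq> tverts (Bound_bang R)"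
      "tarcs (full_subgraph R A') = {e \<in> tarcs (Bound_bang R). tgt R e \<in> A'}"
    and agree: "\<And>x. x \<in> tverts I \<Longrightarrow> vmap i1 x \<in> A \<longleftrightarrow> vmap i2 x \<in> A'"
  shows "is_iso (full_subgraph L A) (full_subgraph R A') (i2 \<circ>\<^sub>g ginv I i1)"
proof -
  note d1 = boundary_embeddingD[OF i1] and d2 = boundary_embeddingD[OF i2]
  let ?g = "ginv I i1" and ?L = "full_subgraph L A" and ?R = "full_subgraph R A'"
  let ?h = "i2 \<circ>\<^sub>g ?g"
  note g = ginv_simps[OF d1(2,3)]
  have gm: "is_mor (Bound_bang L) I ?g"
    using is_iso_ginv(2)[OF I d1(4,2,3)] by (simp add: is_iso_def)
  have hm: "is_mor (Bound_bang L) (Bound_bang R) ?h"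
    by (rule is_mor_gcomp[OF gm d2(4)])
  have hv: "bij_betw (vmap ?h) (tverts (Bound_bang L)) (tverts (Bound_bang R))"
    using bij_betw_trans[OF bij_betw_inv_into[OF d1(2)] d2(2)] by (simp add: gcomp_def ginv_def)
  have he: "bij_betw (emap ?h) (tarcs (Bound_bang L)) (tarcs (Bound_bang R))"
    using bij_betw_trans[OF bij_betw_inv_into[OF d1(3)] d2(3)] by (simp add: gcomp_def ginv_def)
  have mem: "y \<in> A \<longleftrightarrow> vmap ?h y \<in> A'" if "y \<in> tverts (Bound_bang L)" for y
    using agree[OF g(5)[OF that]] g(3)[OF that] by (simp add: gcomp_def)
  have "bij_betw (vmap ?h) {y \<in> tverts (Bound_bang L). y \<in> A} {y \<in> tverts (Bound_bang R). y \<in> A'}"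
    by (rule bij_betw_filter[OF hv]) (rule mem)
  moreover have "{y \<in> tverts (Bound_bang L). y \<in> A} = tverts ?L"
    "{y \<in> tverts (Bound_bang R). y \<in> A'} = tverts ?R"
    using AL(1) AR(1) by auto
  ultimately have bv: "bij_betw (vmap ?h) (tverts ?L) (tverts ?R)"
    by simp
  have tgt: "tgt R (emap ?h e) = vmap ?h (tgt L e)" "src R (emap ?h e) = vmap ?h (src L e)"
    if "e \<in> tarcs (Bound_bang L)" for e
    using is_morD(3,4)[OF hm that] by (simp_all only: Bound_bang_simps)
  have tb: "tgt L e \<in> tverts (Bound_bang L)" if "e \<in> tarcs (Bound_bang L)" for e
    using that by simp
  have be: "bij_betw (emap ?h) (tarcs ?L) (tarcs ?R)"
    unfolding AL(2) AR(2)
    by (rule bij_betw_filter[OF he]) (simp only: tgt mem[OF tb])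
  have "is_mor ?L ?R ?h"
  proof (rule is_morI)
    fix e assume e: "e \<in> tarcs ?L"
    then have e': "e \<in> tarcs (Bound_bang L)"
      unfolding AL(2) by blast
    show "src ?R (emap ?h e) = vmap ?h (src ?L e)" "tgt ?R (emap ?h e) = vmap ?h (tgt ?L e)"
      using tgt[OF e'] by simp_all
    show "etype ?R (emap ?h e) = etype ?L e"
      using is_morD(6)[OF hm e'] by simp
    show "emap ?h e \<in> tarcs ?R"
      using be e by (rule bij_betw_apply)
  next
    fix v assume v: "v \<in> tverts ?L"
    then have v': "v \<in> tverts (Bound_bang L)"
      using AL(1) by auto
    show "vtype ?R (vmap ?h v) = vtype ?L v"
      using is_morD(5)[OF hm v'] by simp
    show "vmap ?h v \<in> tverts ?R"
      using bv v by (rule bij_betw_apply)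
  qed
  moreover have "wf_digraph (under ?L)"
    using L by (simp add: full_subgraph_def wf_digraph.wellformed_induce_subgraph)
  ultimately show ?thesis
    using bv be by (intro is_iso_ginv(1))
qed

text \<open>The commuting conditions on \<open>\<phi>I\<close> and \<open>\<phi>O\<close> force both
  to be \<open>i2\<close> after the inverse of \<open>i1\<close>; this is what matches inputs with
  inputs and outputs with outputs.\<close>

lemma bang_graph_equationD:
  fixes L :: "('v1, 'e1, 'o, 'm) tgraph" and R :: "('v2, 'e2, 'o, 'm) tgraph"
  assumes eq: "bang_graph_equation T L I R i1 i2"
  shows "boundary_embedding I L i1" "boundary_embedding I R i2"
    and "x \<in> tverts I \<Longrightarrow> vmap i1 x \<in> inputs (U_part L) \<longleftrightarrow> vmap i2 x \<in> inputs (U_part R)"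
    and "x \<in> tverts I \<Longrightarrow> vmap i1 x \<in> outputs (U_part L) \<longleftrightarrow> vmap i2 x \<in> outputs (U_part R)"
proof -
  from eq obtain \<phi>I \<phi>O \<phi>L \<phi>R where
    m: "is_mor I L i1" "is_mor I R i2"
    and L: "is_iso (Bound_bang L) I \<phi>L" "mor_eq (In_bang L) (i1 \<circ>\<^sub>g (\<phi>L \<circ>\<^sub>g incl)) incl"
      "mor_eq (Out_bang L) (i1 \<circ>\<^sub>g (\<phi>L \<circ>\<^sub>g incl)) incl"
    and R: "is_iso (Bound_bang R) I \<phi>R" "mor_eq (In_bang R) (i2 \<circ>\<^sub>g (\<phi>R \<circ>\<^sub>g incl)) incl"
      "mor_eq (Out_bang R) (i2 \<circ>\<^sub>g (\<phi>R \<circ>\<^sub>g incl)) incl"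
    and In: "is_iso (In_bang L) (In_bang R) \<phi>I"
      "mor_eq (In_bang L) (\<phi>R \<circ>\<^sub>g incl \<circ>\<^sub>g \<phi>I) (\<phi>L \<circ>\<^sub>g incl)"
    and Out: "is_iso (Out_bang L) (Out_bang R) \<phi>O"
      "mor_eq (Out_bang L) (\<phi>R \<circ>\<^sub>g incl \<circ>\<^sub>g \<phi>O) (\<phi>L \<circ>\<^sub>g incl)"
    unfolding bang_graph_equation_def Let_def by (elim conjE exE) rule
  note e1 = boundary_embedding_of_iso[OF m(1) L] and e2 = boundary_embedding_of_iso[OF m(2) R]
  show "boundary_embedding I L i1" "boundary_embedding I R i2"
    by (fact e1(1) e2(1))+
  have agree: "vmap i1 x \<in> tverts A \<longleftrightarrow> vmap i2 x \<in> tverts A'"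
    if x: "x \<in> tverts I" and iso: "is_iso A A' \<phi>"
      and comm: "mor_eq A (\<phi>R \<circ>\<^sub>g incl \<circ>\<^sub>g \<phi>) (\<phi>L \<circ>\<^sub>g incl)"
      and sub: "tverts A \<subseteq> tverts (Bound_bang L)" "tverts A' \<subseteq> tverts (Bound_bang R)"
    for x and A :: "('v1, 'e1, 'o, 'm) tgraph" and A' :: "('v2, 'e2, 'o, 'm) tgraph" and \<phi>
  proof -
    from iso obtain g where \<phi>: "is_mor A A' \<phi>" and g: "is_mor A' A g"
      and \<phi>g: "\<And>y. y \<in> tverts A' \<Longrightarrow> vmap \<phi> (vmap g y) = y"
      by (auto simp: is_iso_def mor_eq_def gcomp_def incl_def)
    have c: "vmap \<phi>R (vmap \<phi> y) = vmap \<phi>L y" if "y \<in> tverts A" for y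
      using comm that by (auto simp: mor_eq_def gcomp_def incl_def)
    show ?thesis
    proof
      assume y: "vmap i1 x \<in> tverts A"
      \<comment> \<open>Applying \<open>i2\<close>, which undoes \<open>\<phi>R\<close>, turns this
        into \<open>vmap \<phi> (vmap i1 x) = vmap i2 x\<close>.\<close>
      have "vmap \<phi>R (vmap \<phi> (vmap i1 x)) = x"
        using c[OF y] e1(3)[OF x] by simp
      moreover have "vmap \<phi> (vmap i1 x) \<in> tverts A'"
        using is_morD(1)[OF \<phi> y] .
      ultimately show "vmap i2 x \<in> tverts A'"
        using e2(2) sub(2) by (metis subsetD)
    next
      assume y: "vmap i2 x \<in> tverts A'"
      have gy: "vmap g (vmap i2 x) \<in> tverts A"
        using is_morD(1)[OF g y] .
      then have "vmap \<phi>L (vmap g (vmap i2 x)) = x"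
        using c[OF gy] \<phi>g[OF y] e2(3)[OF x] by simp
      then show "vmap i1 x \<in> tverts A"
        using e1(2) sub(1) gy by (metis subsetD)
    qed
  qed
  assume x: "x \<in> tverts I"
  have ty: "vtype L (vmap i1 x) = vtype R (vmap i2 x)"
    using is_morD(5)[OF m(1) x] is_morD(5)[OF m(2) x] by simp
  \<comment> \<open>\<open>In_bang\<close> and \<open>Out_bang\<close> also contain the !-vertices;
    legs preserve types, so these can be discarded on both sides at once.\<close>
  have nb: "inputs (U_part L) = tverts (In_bang L) - {v. vtype L v = Bang}"
    "inputs (U_part R) = tverts (In_bang R) - {v. vtype R v = Bang}"
    "outputs (U_part L) = tverts (Out_bang L) - {v. vtype L v = Bang}"
    "outputs (U_part R) = tverts (Out_bang R) - {v. vtype R v = Bang}"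
    by (auto simp: In_bang_def Out_bang_def bang_verts_def inputs_def outputs_def U_part_eq wire_verts_def)
  have "vmap i1 x \<in> tverts (In_bang L) \<longleftrightarrow> vmap i2 x \<in> tverts (In_bang R)"
    by (rule agree[OF x In]) (auto simp: In_bang_def)
  then show "vmap i1 x \<in> inputs (U_part L) \<longleftrightarrow> vmap i2 x \<in> inputs (U_part R)"
    unfolding nb using ty by simp
  have "vmap i1 x \<in> tverts (Out_bang L) \<longleftrightarrow> vmap i2 x \<in> tverts (Out_bang R)"
    by (rule agree[OF x Out]) (auto simp: Out_bang_def)
  then show "vmap i1 x \<in> outputs (U_part L) \<longleftrightarrow> vmap i2 x \<in> outputs (U_part R)"
    unfolding nb using ty by simp
qed

text \<open>The single map \<open>i2 \<circ>\<^sub>g ginv I i1\<close> serves as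
  \<open>\<phi>I\<close> and as \<open>\<phi>O\<close>; the agreement hypotheses say that it
  respects both kinds of boundary.\<close>

lemma bang_graph_equationI:
  assumes bg: "bang_graph T L" "bang_graph T I" "bang_graph T R"
    and iso: "isolated_wires (U_part L) = {}" "isolated_wires (U_part R) = {}"
    and i1: "boundary_embedding I L i1" and i2: "boundary_embedding I R i2"
    and inp: "\<And>x. x \<in> tverts I \<Longrightarrow>
      vmap i1 x \<in> inputs (U_part L) \<longleftrightarrow> vmap i2 x \<in> inputs (U_part R)"
    and outp: "\<And>x. x \<in> tverts I \<Longrightarrow>
      vmap i1 x \<in> outputs (U_part L) \<longleftrightarrow> vmap i2 x \<in> outputs (U_part R)"
  shows "bang_graph_equation T L I R i1 i2"
proof -
  note d1 = boundary_embeddingD[OF i1] and d2 = boundary_embeddingD[OF i2]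
  note tg = bg[THEN bang_graphD(1)]
  note wf = tg[THEN typed_graphD(5)]
  let ?L = "ginv I i1" and ?R = "ginv I i2"
  let ?\<phi> = "i2 \<circ>\<^sub>g ?L"
  note gL = ginv_simps[OF d1(2,3)] and gR = ginv_simps[OF d2(2,3)]
  have bang: "vmap i1 x \<in> bang_verts L \<longleftrightarrow> vmap i2 x \<in> bang_verts R" if "x \<in> tverts I" for x
    using is_morD(1,5)[OF d1(1) that] is_morD(1,5)[OF d2(1) that] by (simp add: bang_verts_def)
  have inc: "mor_eq A (i1 \<circ>\<^sub>g (?L \<circ>\<^sub>g incl)) incl" "mor_eq A (?R \<circ>\<^sub>g incl \<circ>\<^sub>g ?\<phi>) (?L \<circ>\<^sub>g incl)"
    if "tverts A \<subseteq> tverts (Bound_bang L)" "tarcs A \<subseteq> tarcs (Bound_bang L)" for A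
    using that gL(3-6) gR(1,2) unfolding mor_eq_def gcomp_def incl_def by (auto simp del: Bound_bang_simps)
  have inc': "mor_eq A (i2 \<circ>\<^sub>g (?R \<circ>\<^sub>g incl)) incl"
    if "tverts A \<subseteq> tverts (Bound_bang R)" "tarcs A \<subseteq> tarcs (Bound_bang R)" for A
    using that gR(3-6) unfolding mor_eq_def gcomp_def incl_def by (auto simp del: Bound_bang_simps)
  have subL: "tverts (In_bang L) \<subseteq> tverts (Bound_bang L)" "tverts (Out_bang L) \<subseteq> tverts (Bound_bang L)"
    "tarcs (In_bang L) \<subseteq> tarcs (Bound_bang L)" "tarcs (Out_bang L) \<subseteq> tarcs (Bound_bang L)"
    unfolding full_boundary_arcs[OF tg(1)] by (auto simp: In_bang_def Out_bang_def)
  have subR: "tverts (In_bang R) \<subseteq> tverts (Bound_bang R)" "tverts (Out_bang R) \<subseteq> tverts (Bound_bang R)"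
    "tarcs (In_bang R) \<subseteq> tarcs (Bound_bang R)" "tarcs (Out_bang R) \<subseteq> tarcs (Bound_bang R)"
    unfolding full_boundary_arcs[OF tg(3)] by (auto simp: In_bang_def Out_bang_def)
  note iso_between = is_iso_between_boundaries[OF wf(2,1) i1 i2]
  have "is_iso (In_bang L) (In_bang R) ?\<phi>"
    unfolding In_bang_def
    by (rule iso_between; use subL(1) subR(1) full_boundary_arcs(1)[OF tg(1)]
        full_boundary_arcs(1)[OF tg(3)] bang inp in \<open>simp add: In_bang_def\<close>)
  moreover have "is_iso (Out_bang L) (Out_bang R) ?\<phi>"
    unfolding Out_bang_def
    by (rule iso_between; use subL(2) subR(2) full_boundary_arcs(2)[OF tg(1)]
        full_boundary_arcs(2)[OF tg(3)] bang outp in \<open>simp add: Out_bang_def\<close>)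
  moreover have "is_iso (Bound_bang L) I ?L" "is_iso (Bound_bang R) I ?R"
    by (rule is_iso_ginv(2)[OF wf(2) d1(4,2,3)], rule is_iso_ginv(2)[OF wf(2) d2(4,2,3)])
  ultimately show ?thesis
    unfolding bang_graph_equation_def Let_def
    using bg d1(1) d2(1) iso inc[OF subL(1,3)] inc[OF subL(2,4)] inc'[OF subR(1,3)] inc'[OF subR(2,4)]
    by blast
qed

section \<open>The operations on equations\<close>

lemma boundary_remove_verts:
  assumes G: "bang_graph T G" and op: "wire_open G D"
  shows "inputs (U_part (remove_verts G D)) = inputs (U_part G) - D"
    and "outputs (U_part (remove_verts G D)) = outputs (U_part G) - D"
    and "isolated_wires (U_part G) = {} \<Longrightarrow> isolated_wires (U_part (remove_verts G D)) = {}"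
proof -
  note Gt = bang_graphD(1)[OF G]
  note Ht = bang_graphD(1)[OF bang_graph_remove_verts[OF G op]]
  note rs = remove_verts_simps[OF Gt]
  \<comment> \<open>Openness read contrapositively: a wiring arc at a surviving wire-vertex has its
    other end outside \<open>D\<close>, so the arc survives.\<close>
  have tgt: "src G e \<notin> D" if "e \<in> wiring_arcs G" "tgt G e \<in> wire_verts G" "tgt G e \<notin> D" for e
    using wire_openD(1)[OF op that(1)] that by blast
  have src: "tgt G e \<notin> D" if "e \<in> wiring_arcs G" "src G e \<in> wire_verts G" "src G e \<notin> D" for e
    using wire_openD(2)[OF op that(1)] that by blast
  show "inputs (U_part (remove_verts G D)) = inputs (U_part G) - D"
  proof (rule set_eqI)
    show "w \<in> inputs (U_part (remove_verts G D)) \<longleftrightarrow> w \<in> inputs (U_part G) - D" for w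
      unfolding Diff_iff inputs_U_part_iff[OF Gt] inputs_U_part_iff[OF Ht] rs using tgt by blast
  qed
  show "outputs (U_part (remove_verts G D)) = outputs (U_part G) - D"
  proof (rule set_eqI)
    show "w \<in> outputs (U_part (remove_verts G D)) \<longleftrightarrow> w \<in> outputs (U_part G) - D" for w
      unfolding Diff_iff outputs_U_part_iff[OF Gt] outputs_U_part_iff[OF Ht] rs using src by blast
  qed
  assume iso: "isolated_wires (U_part G) = {}"
  show "isolated_wires (U_part (remove_verts G D)) = {}"
    unfolding no_isolated_wires_iff[OF Ht] rs
  proof
    fix w assume w: "w \<in> wire_verts G - D"
    then obtain e where "e \<in> wiring_arcs G" "src G e = w \<or> tgt G e = w"
      using iso unfolding no_isolated_wires_iff[OF Gt] by blast
    then show "\<exists>e \<in> {e \<in> wiring_arcs G. src G e \<notin> D \<and> tgt G e \<notin> D}. src G e = w \<or> tgt G e = w"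
      using w src[of e] tgt[of e] by blast
  qed
qed

text \<open>Within \<open>I\<close>, \<open>D'\<close> is the preimage of \<open>D\<close>, so a
  vertex or arc survives exactly when its image does, and the two bijections restrict.\<close>

lemma boundary_embedding_remove_verts:
  assumes G: "bang_graph T G" and I: "bang_graph T I" and i: "boundary_embedding I G i"
    and op: "wire_open G D" and D: "\<And>x. x \<in> tverts I \<Longrightarrow> x \<in> D' \<longleftrightarrow> vmap i x \<in> D"
  shows "boundary_embedding (remove_verts I D') (remove_verts G D)
    (restrict_mor (remove_verts I D') i)"
proof -
  let ?I = "remove_verts I D'" and ?G = "remove_verts G D"
  let ?i = "restrict_mor ?I i"
  note Gt = bang_graphD(1)[OF G] and It = bang_graphD(1)[OF I]
  note gs = remove_verts_simps[OF Gt] and isimps = remove_verts_simps[OF It]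
  note d = boundary_embeddingD[OF i]
  have ends: "src I e \<in> tverts I" "tgt I e \<in> tverts I" if "e \<in> tarcs I" for e
    using typed_graphD(1,2)[OF It that] .
  have ri: "x \<in> tverts ?I \<Longrightarrow> vmap ?i x = vmap i x" "e \<in> tarcs ?I \<Longrightarrow> emap ?i e = emap i e" for x e
    by (simp_all add: restrict_mor_def)
  have Dv: "x \<notin> D' \<longleftrightarrow> vmap i x \<notin> D" if "x \<in> tverts I" for x
    using D[OF that] by simp
  have De: "(src I e \<notin> D' \<and> tgt I e \<notin> D') \<longleftrightarrow>
      (src G (emap i e) \<notin> D \<and> tgt G (emap i e) \<notin> D)" if "e \<in> tarcs I" for e
    using Dv[OF ends(1)[OF that]] Dv[OF ends(2)[OF that]] is_morD(3,4)[OF d(1) that] by simp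
  have "is_mor ?I ?G ?i"
  proof (rule is_morI)
    fix e assume e: "e \<in> tarcs ?I"
    then have e': "e \<in> tarcs I" "src I e \<notin> D'" "tgt I e \<notin> D'"
      by (simp_all add: isimps)
    have m: "src I e \<in> tverts ?I" "tgt I e \<in> tverts ?I"
      using e' ends by (simp_all add: isimps)
    show "emap ?i e \<in> tarcs ?G" "src ?G (emap ?i e) = vmap ?i (src ?I e)"
      "tgt ?G (emap ?i e) = vmap ?i (tgt ?I e)" "etype ?G (emap ?i e) = etype ?I e"
      using De[OF e'(1)] e' is_morD[OF d(1)] ri(2)[OF e] ri(1)[OF m(1)] ri(1)[OF m(2)]
      by (auto simp: gs isimps)
  next
    fix v assume v: "v \<in> tverts ?I"
    then show "vmap ?i v \<in> tverts ?G" "vtype ?G (vmap ?i v) = vtype ?I v"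
      using Dv[of v] is_morD[OF d(1)] ri(1)[OF v] by (auto simp: gs isimps)
  qed
  moreover have "bij_betw (vmap ?i) (tverts ?I) (tverts (Bound_bang ?G))"
  proof -
    have "tverts ?I = {x \<in> tverts I. x \<notin> D'}"
      by (auto simp: isimps)
    moreover have "tverts (Bound_bang ?G) = {y \<in> tverts (Bound_bang G). y \<notin> D}"
      by (auto simp: gs boundary_remove_verts[OF G op])
    moreover have "bij_betw (vmap i) {x \<in> tverts I. x \<notin> D'} {y \<in> tverts (Bound_bang G). y \<notin> D}"
      by (rule bij_betw_filter[OF d(2)]) (rule Dv)
    ultimately show ?thesis
      using bij_betw_cong[of "tverts ?I" "vmap ?i" "vmap i", OF ri(1)] by simp
  qed
  moreover have "bij_betw (emap ?i) (tarcs ?I) (tarcs (Bound_bang ?G))"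
  proof -
    have "tarcs (Bound_bang ?G) = {a \<in> tarcs (Bound_bang G). src G a \<notin> D \<and> tgt G a \<notin> D}"
      by (auto simp: gs boundary_remove_verts[OF G op])
    moreover have "bij_betw (emap i) {e \<in> tarcs I. src I e \<notin> D' \<and> tgt I e \<notin> D'}
        {a \<in> tarcs (Bound_bang G). src G a \<notin> D \<and> tgt G a \<notin> D}"
      by (rule bij_betw_filter[OF d(3)]) (rule De)
    ultimately have "bij_betw (emap i) (tarcs ?I) (tarcs (Bound_bang ?G))"
      by (simp only: isimps)
    then show ?thesis
      using bij_betw_cong[of "tarcs ?I" "emap ?i" "emap i", OF ri(2)] by blast
  qed
  ultimately show ?thesis
    unfolding boundary_embedding_def by blast
qed

lemma bang_graph_equation_remove_verts:
  assumes eq: "bang_graph_equation T L I R i1 i2"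
    and op: "wire_open L D1" "wire_open I D" "wire_open R D2"
    and D: "\<And>x. x \<in> tverts I \<Longrightarrow> x \<in> D \<longleftrightarrow> vmap i1 x \<in> D1"
      "\<And>x. x \<in> tverts I \<Longrightarrow> x \<in> D \<longleftrightarrow> vmap i2 x \<in> D2"
  shows "bang_graph_equation T (remove_verts L D1) (remove_verts I D) (remove_verts R D2)
    (restrict_mor (remove_verts I D) i1) (restrict_mor (remove_verts I D) i2)"
proof -
  have bg: "bang_graph T L" "bang_graph T I" "bang_graph T R"
    and iso: "isolated_wires (U_part L) = {}" "isolated_wires (U_part R) = {}"
    using eq by (simp_all add: bang_graph_equation_def)
  note d = bang_graph_equationD[OF eq]
  have x: "x \<in> tverts I \<and> x \<notin> D \<and>
      vmap (restrict_mor (remove_verts I D) i1) x = vmap i1 x \<and>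
      vmap (restrict_mor (remove_verts I D) i2) x = vmap i2 x"
    if "x \<in> tverts (remove_verts I D)" for x
    using that by (auto simp: restrict_mor_def remove_verts_def)
  show ?thesis
  proof (rule bang_graph_equationI)
    show "bang_graph T (remove_verts L D1)" "bang_graph T (remove_verts I D)"
      "bang_graph T (remove_verts R D2)"
      using bg op by (simp_all add: bang_graph_remove_verts)
    show "isolated_wires (U_part (remove_verts L D1)) = {}"
      "isolated_wires (U_part (remove_verts R D2)) = {}"
      by (rule boundary_remove_verts(3)[OF bg(1) op(1) iso(1)]
          boundary_remove_verts(3)[OF bg(3) op(3) iso(2)])+
    show "boundary_embedding (remove_verts I D) (remove_verts L D1) (restrict_mor (remove_verts I D) i1)"
      by (rule boundary_embedding_remove_verts[OF bg(1,2) d(1) op(1) D(1)])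
    show "boundary_embedding (remove_verts I D) (remove_verts R D2) (restrict_mor (remove_verts I D) i2)"
      by (rule boundary_embedding_remove_verts[OF bg(3,2) d(2) op(3) D(2)])
  next
    fix y assume "y \<in> tverts (remove_verts I D)"
    note y = x[OF this]
    show "vmap (restrict_mor (remove_verts I D) i1) y \<in> inputs (U_part (remove_verts L D1)) \<longleftrightarrow>
        vmap (restrict_mor (remove_verts I D) i2) y \<in> inputs (U_part (remove_verts R D2))"
      "vmap (restrict_mor (remove_verts I D) i1) y \<in> outputs (U_part (remove_verts L D1)) \<longleftrightarrow>
        vmap (restrict_mor (remove_verts I D) i2) y \<in> outputs (U_part (remove_verts R D2))"
      unfolding boundary_remove_verts(1,2)[OF bg(1) op(1)] boundary_remove_verts(1,2)[OF bg(3) op(3)]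
      using y d(3,4)[of y] D[of y] by simp_all
  qed
qed

lemma boundary_embedding_bang:
  assumes "boundary_embedding I G i" "b \<in> bang_verts I"
  shows "vmap i b \<in> bang_verts G"
  using is_morD(1,5)[OF boundary_embeddingD(1)[OF assms(1)], of b] assms(2)
  by (simp add: bang_verts_def)

text \<open>Any morphism sends containment to containment; the converse is reflection together with
  injectivity.\<close>

lemma boundary_embedding_box:
  assumes i: "boundary_embedding I G i" and I: "wf_digraph (under I)"
    and b: "b \<in> bang_verts I" and v: "v \<in> tverts I"
  shows "v \<in> box I b \<longleftrightarrow> vmap i v \<in> box G (vmap i b)"
proof
  assume "v \<in> box I b"
  then show "vmap i v \<in> box G (vmap i b)"
    using is_morD(2-4)[OF boundary_embeddingD(1)[OF i]] unfolding in_box_iff by metis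
qed (rule bang_box_reflect[OF boundary_embeddingD(1,5,6)[OF i] I b v])

section \<open>Boundaries under COPY\<close>

text \<open>\<open>coproj2\<close> sets the tag only outside the shared part, so the image has tag
  \<open>k\<close> cut down to elements that are doubled in \<open>H\<close>.\<close>

lemma COPY_mor_simps:
  assumes f: "is_mor G H f" and H: "typed_graph TH H"
  shows "v \<in> tverts G \<Longrightarrow>
      vmap (COPY_mor b H f) (v, k) = (vmap f v, k \<and> vmap f v \<in> box H (vmap f b))"
    and "e \<in> tarcs G \<Longrightarrow> emap (COPY_mor b H f) (e, k) = (emap f e,
      k \<and> (src H (emap f e) \<in> box H (vmap f b) \<or> tgt H (emap f e) \<in> box H (vmap f b)))"
  using is_morD(1,2)[OF f] typed_graphD(1,2)[OF H]
  by (auto simp: COPY_mor_def cotuple_def gcomp_def copy_proj1_def copy_proj2_def coproj1_def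
      coproj2_def remove_verts_def)

text \<open>Wiring arcs of the copy project to wiring arcs of \<open>G\<close>. Conversely, an arc
  at \<open>w\<close> lifts to one at each copy of \<open>w\<close>, because a second copy of
  \<open>w\<close> exists only inside the box, where all arcs at \<open>w\<close> are
  doubled.\<close>

lemma boundary_COPY:
  assumes G: "bang_graph T G" and b: "b \<in> bang_verts G"
  shows "(w, k) \<in> inputs (U_part (COPY b G)) \<longleftrightarrow> w \<in> inputs (U_part G) \<and> (k \<longrightarrow> w \<in> box G b)"
    and "(w, k) \<in> outputs (U_part (COPY b G)) \<longleftrightarrow> w \<in> outputs (U_part G) \<and> (k \<longrightarrow> w \<in> box G b)"
    and "isolated_wires (U_part G) = {} \<Longrightarrow> isolated_wires (U_part (COPY b G)) = {}"
proof -
  note Gt = bang_graphD(1)[OF G] and Ct = bang_graphD(1)[OF bang_graph_COPY[OF G b]]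
  note cs = COPY_simps[OF Gt] COPY_vertex_simps[OF Gt]
  have lift_tgt: "\<exists>a \<in> wiring_arcs (COPY b G). tgt (COPY b G) a = (tgt G e, k)"
    if "e \<in> wiring_arcs G" "k \<longrightarrow> tgt G e \<in> box G b" for e k
    using that by (intro bexI[of _ "(e, k)"]) (auto simp: cs wiring_arcs_iff[OF Gt])
  have lift_src: "\<exists>a \<in> wiring_arcs (COPY b G). src (COPY b G) a = (src G e, k)"
    if "e \<in> wiring_arcs G" "k \<longrightarrow> src G e \<in> box G b" for e k
    using that by (intro bexI[of _ "(e, k)"]) (auto simp: cs wiring_arcs_iff[OF Gt])
  have proj: "\<exists>e \<in> wiring_arcs G. src G e = fst (src (COPY b G) a) \<and> tgt G e = fst (tgt (COPY b G) a)"
    if "a \<in> wiring_arcs (COPY b G)" for a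
    using that by (cases a) (auto simp: cs wiring_arcs_iff[OF Gt])
  show "(w, k) \<in> inputs (U_part (COPY b G)) \<longleftrightarrow> w \<in> inputs (U_part G) \<and> (k \<longrightarrow> w \<in> box G b)"
    unfolding inputs_U_part_iff[OF Gt] inputs_U_part_iff[OF Ct] cs
    using lift_tgt proj by (metis fst_conv)
  show "(w, k) \<in> outputs (U_part (COPY b G)) \<longleftrightarrow> w \<in> outputs (U_part G) \<and> (k \<longrightarrow> w \<in> box G b)"
    unfolding outputs_U_part_iff[OF Gt] outputs_U_part_iff[OF Ct] cs
    using lift_src proj by (metis fst_conv)
  assume iso: "isolated_wires (U_part G) = {}"
  show "isolated_wires (U_part (COPY b G)) = {}"
    unfolding no_isolated_wires_iff[OF Ct]
  proof
    fix x assume x: "x \<in> wire_verts (COPY b G)"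
    obtain w k where wk: "x = (w, k)" by (cases x)
    have w: "w \<in> wire_verts G" "k \<longrightarrow> w \<in> box G b"
      using x by (simp_all add: wk cs)
    then obtain e where "e \<in> wiring_arcs G" "src G e = w \<or> tgt G e = w"
      using iso unfolding no_isolated_wires_iff[OF Gt] by blast
    then show "\<exists>a \<in> wiring_arcs (COPY b G). src (COPY b G) a = x \<or> tgt (COPY b G) a = x"
      using lift_src[of e k] lift_tgt[of e k] w(2) unfolding wk by blast
  qed
qed

text \<open>\<open>P\<close> and \<open>Q\<close> mark the doubled elements on the two sides: for
  vertices, those in the box; for arcs, those with some end in the box.\<close>

lemma bij_betw_copy:
  assumes f: "bij_betw f A B" and PQ: "\<And>x. x \<in> A \<Longrightarrow> P x \<longleftrightarrow> Q (f x)"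
    and h: "\<And>x k. x \<in> A \<Longrightarrow> h (x, k) = (f x, k \<and> Q (f x))"
  shows "bij_betw h {(x, k). x \<in> A \<and> (k \<longrightarrow> P x)} {(y, k). y \<in> B \<and> (k \<longrightarrow> Q y)}"
proof (rule bij_betw_imageI)
  show "inj_on h {(x, k). x \<in> A \<and> (k \<longrightarrow> P x)}"
    using f PQ by (auto simp: h bij_betw_def inj_on_def)
  show "h ` {(x, k). x \<in> A \<and> (k \<longrightarrow> P x)} = {(y, k). y \<in> B \<and> (k \<longrightarrow> Q y)}"
  proof (intro set_eqI iffI)
    fix z assume "z \<in> h ` {(x, k). x \<in> A \<and> (k \<longrightarrow> P x)}"
    then show "z \<in> {(y, k). y \<in> B \<and> (k \<longrightarrow> Q y)}"
      using bij_betw_apply[OF f] by (auto simp: h)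
  next
    fix z assume "z \<in> {(y, k). y \<in> B \<and> (k \<longrightarrow> Q y)}"
    then obtain y k where z: "z = (y, k)" "y \<in> B" "k \<longrightarrow> Q y" by blast
    obtain x where x: "x \<in> A" "y = f x"
      using f z(2) by (auto simp: bij_betw_def)
    have "z = h (x, k)" "(x, k) \<in> {(x, k). x \<in> A \<and> (k \<longrightarrow> P x)}"
      using z x PQ by (auto simp: h)
    then show "z \<in> h ` {(x, k). x \<in> A \<and> (k \<longrightarrow> P x)}"
      by blast
  qed
qed

lemma boundary_embedding_COPY:
  assumes G: "bang_graph T G" and I: "bang_graph T I" and i: "boundary_embedding I G i"
    and b: "b \<in> bang_verts I"
  shows "boundary_embedding (COPY b I) (COPY (vmap i b) G) (COPY_mor b G i)"
proof -
  let ?c = "vmap i b" and ?h = "COPY_mor b G i"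
  let ?B = "box G ?c"
  note Gt = bang_graphD(1)[OF G] and It = bang_graphD(1)[OF I]
  note d = boundary_embeddingD[OF i]
  note c = boundary_embedding_bang[OF i b]
  note cs = COPY_simps[OF Gt] COPY_vertex_simps[OF Gt]
  note box = boundary_embedding_box[OF i typed_graphD(5)[OF It] b]
  have "is_mor (COPY b I) (COPY ?c G) ?h"
    by (rule COPY_mor_unique(1)[OF d(1,5,6) typed_graphD(5)[OF It] typed_graphD(5)[OF Gt] b])
  moreover have "bij_betw (vmap ?h) (tverts (COPY b I)) (tverts (Bound_bang (COPY ?c G)))"
  proof -
    have "tverts (COPY b I) = {(x, k). x \<in> tverts I \<and> (k \<longrightarrow> x \<in> box I b)}"
      by (auto simp: COPY_simps[OF It])
    moreover have "tverts (Bound_bang (COPY ?c G)) = {(y, k). y \<in> tverts (Bound_bang G) \<and> (k \<longrightarrow> y \<in> ?B)}"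
      by (auto simp: cs boundary_COPY[OF G c])
    moreover have "bij_betw (vmap ?h) {(x, k). x \<in> tverts I \<and> (k \<longrightarrow> x \<in> box I b)}
        {(y, k). y \<in> tverts (Bound_bang G) \<and> (k \<longrightarrow> y \<in> ?B)}"
      by (rule bij_betw_copy[OF d(2)]) (simp_all only: box COPY_mor_simps[OF d(1) Gt])
    ultimately show ?thesis
      by (simp only:)
  qed
  moreover have "bij_betw (emap ?h) (tarcs (COPY b I)) (tarcs (Bound_bang (COPY ?c G)))"
  proof -
    have "tarcs (COPY b I) = {(e, k). e \<in> tarcs I \<and> (k \<longrightarrow> src I e \<in> box I b \<or> tgt I e \<in> box I b)}"
      by (auto simp: COPY_simps[OF It])
    moreover have "tarcs (Bound_bang (COPY ?c G)) =
        {(a, k). a \<in> tarcs (Bound_bang G) \<and> (k \<longrightarrow> src G a \<in> ?B \<or> tgt G a \<in> ?B)}"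
      by (auto simp: cs boundary_COPY[OF G c])
    moreover have "bij_betw (emap ?h)
        {(e, k). e \<in> tarcs I \<and> (k \<longrightarrow> src I e \<in> box I b \<or> tgt I e \<in> box I b)}
        {(a, k). a \<in> tarcs (Bound_bang G) \<and> (k \<longrightarrow> src G a \<in> ?B \<or> tgt G a \<in> ?B)}"
      by (rule bij_betw_copy[OF d(3)])
        (simp_all only: box typed_graphD(1,2)[OF It] is_morD(3,4)[OF d(1)] COPY_mor_simps[OF d(1) Gt])
    ultimately show ?thesis
      by (simp only:)
  qed
  ultimately show ?thesis
    unfolding boundary_embedding_def by blast
qed

lemma bang_graph_equation_COPY:
  assumes eq: "bang_graph_equation T L I R i1 i2" and b: "b \<in> bang_verts I"
  shows "bang_graph_equation T (COPY (vmap i1 b) L) (COPY b I) (COPY (vmap i2 b) R)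
    (COPY_mor b L i1) (COPY_mor b R i2)"
proof -
  have bg: "bang_graph T L" "bang_graph T I" "bang_graph T R"
    and iso: "isolated_wires (U_part L) = {}" "isolated_wires (U_part R) = {}"
    using eq by (simp_all add: bang_graph_equation_def)
  note d = bang_graph_equationD[OF eq]
  note b1 = boundary_embedding_bang[OF d(1) b] and b2 = boundary_embedding_bang[OF d(2) b]
  note It = bang_graphD(1)[OF bg(2)]
  note box1 = boundary_embedding_box[OF d(1) typed_graphD(5)[OF It] b]
    and box2 = boundary_embedding_box[OF d(2) typed_graphD(5)[OF It] b]
  show ?thesis
  proof (rule bang_graph_equationI)
    show "bang_graph T (COPY (vmap i1 b) L)" "bang_graph T (COPY b I)"
      "bang_graph T (COPY (vmap i2 b) R)"
      using bg b b1 b2 by (simp_all add: bang_graph_COPY)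
    show "isolated_wires (U_part (COPY (vmap i1 b) L)) = {}"
      "isolated_wires (U_part (COPY (vmap i2 b) R)) = {}"
      by (rule boundary_COPY(3)[OF bg(1) b1 iso(1)] boundary_COPY(3)[OF bg(3) b2 iso(2)])+
    show "boundary_embedding (COPY b I) (COPY (vmap i1 b) L) (COPY_mor b L i1)"
      "boundary_embedding (COPY b I) (COPY (vmap i2 b) R) (COPY_mor b R i2)"
      by (rule boundary_embedding_COPY[OF bg(1,2) d(1) b] boundary_embedding_COPY[OF bg(3,2) d(2) b])+
  next
    fix y assume y: "y \<in> tverts (COPY b I)"
    obtain x k where xk: "y = (x, k)" by (cases y)
    have x: "x \<in> tverts I" "k \<longrightarrow> x \<in> box I b"
      using y by (simp_all add: xk COPY_simps[OF It])
    \<comment> \<open>A tag \<open>True\<close> occurs only for \<open>x\<close> in the box of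
      \<open>b\<close>, whose images lie in the image boxes, so cutting down the tag changes
      nothing.\<close>
    have v: "vmap (COPY_mor b L i1) y = (vmap i1 x, k)" "vmap (COPY_mor b R i2) y = (vmap i2 x, k)"
      using x box1[OF x(1)] box2[OF x(1)]
        COPY_mor_simps(1)[OF boundary_embeddingD(1)[OF d(1)] bang_graphD(1)[OF bg(1)] x(1)]
        COPY_mor_simps(1)[OF boundary_embeddingD(1)[OF d(2)] bang_graphD(1)[OF bg(3)] x(1)]
      by (auto simp: xk)
    show "vmap (COPY_mor b L i1) y \<in> inputs (U_part (COPY (vmap i1 b) L)) \<longleftrightarrow>
        vmap (COPY_mor b R i2) y \<in> inputs (U_part (COPY (vmap i2 b) R))"
      "vmap (COPY_mor b L i1) y \<in> outputs (U_part (COPY (vmap i1 b) L)) \<longleftrightarrow>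
        vmap (COPY_mor b R i2) y \<in> outputs (U_part (COPY (vmap i2 b) R))"
      unfolding v boundary_COPY[OF bg(1) b1] boundary_COPY[OF bg(3) b2]
      using d(3,4)[OF x(1)] box1[OF x(1)] box2[OF x(1)] by simp_all
  qed
qed

theorem theorem5p8:
  fixes T :: "('o, 'm) signature"
    and L :: "('v1, 'e1, 'o, 'm) tgraph"
    and I :: "('v, 'e, 'o, 'm) tgraph"
    and R :: "('v2, 'e2, 'o, 'm) tgraph"
    and i1 :: "('v, 'e, 'v1, 'e1) gmap"
    and i2 :: "('v, 'e, 'v2, 'e2) gmap"
    and b :: 'v
  assumes "compressed_monoidal_signature T"
    and "bang_graph_equation T L I R i1 i2"
    and "b \<in> bang_verts I"
  shows "bang_graph_equation T (COPY (vmap i1 b) L) (COPY b I) (COPY (vmap i2 b) R)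
           (COPY_mor b L i1) (COPY_mor b R i2)
       \<and> bang_graph_equation T (DROP (vmap i1 b) L) (DROP b I) (DROP (vmap i2 b) R)
           (DROP_mor b I i1) (DROP_mor b I i2)
       \<and> bang_graph_equation T (KILL (vmap i1 b) L) (KILL b I) (KILL (vmap i2 b) R)
           (KILL_mor b I i1) (KILL_mor b I i2)"
proof (intro conjI)
  note eq = assms(2) and b = assms(3)
  have bg: "bang_graph T L" "bang_graph T I" "bang_graph T R"
    using eq by (simp_all add: bang_graph_equation_def)
  note d = bang_graph_equationD[OF eq]
  note b1 = boundary_embedding_bang[OF d(1) b] and b2 = boundary_embedding_bang[OF d(2) b]
  note wf = typed_graphD(5)[OF bang_graphD(1)[OF bg(2)]]
  show "bang_graph_equation T (COPY (vmap i1 b) L) (COPY b I) (COPY (vmap i2 b) R)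
      (COPY_mor b L i1) (COPY_mor b R i2)"
    by (rule bang_graph_equation_COPY[OF eq b])
  \<comment> \<open>Injectivity of the legs makes \<open>{b}\<close> the preimage of the removed
    singletons; for KILL, \<open>boundary_embedding_box\<close> supplies the corresponding fact for
    boxes.\<close>
  have inj: "x \<in> {b} \<longleftrightarrow> vmap i1 x \<in> {vmap i1 b}" "x \<in> {b} \<longleftrightarrow> vmap i2 x \<in> {vmap i2 b}"
    if "x \<in> tverts I" for x
    using that b boundary_embeddingD(5)[OF d(1)] boundary_embeddingD(5)[OF d(2)]
    by (auto simp: monic_def bang_verts_def dest: inj_onD)
  show "bang_graph_equation T (DROP (vmap i1 b) L) (DROP b I) (DROP (vmap i2 b) R)
      (DROP_mor b I i1) (DROP_mor b I i2)"
    unfolding DROP_mor_def DROP_def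
    by (rule bang_graph_equation_remove_verts[OF eq wire_open_bang[OF bg(1) b1]
          wire_open_bang[OF bg(2) b] wire_open_bang[OF bg(3) b2] inj])
  show "bang_graph_equation T (KILL (vmap i1 b) L) (KILL b I) (KILL (vmap i2 b) R)
      (KILL_mor b I i1) (KILL_mor b I i2)"
    unfolding KILL_mor_def KILL_def
    by (rule bang_graph_equation_remove_verts[OF eq bang_graphD(9)[OF bg(1) b1]
          bang_graphD(9)[OF bg(2) b] bang_graphD(9)[OF bg(3) b2]
          boundary_embedding_box[OF d(1) wf b] boundary_embedding_box[OF d(2) wf b]])
qed

end
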